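(* Let $\Gamma$ be an infinite connected subgraph of $\mathbb B$ with natural weights. There exist constants $c_0,c_1,c_2>0$ such that the following holds. Suppose $x_0\in\Gamma$, $r\ge1$, $\lambda\ge1$, $B=B(x_0,r)$ is $\lambda$-good, and let $I=I(\lambda,r)=[r^3\lambda^{-6},r^3\lambda^{-5}]$. Then: (a) for $x\in B(x_0,r/\lambda)$, $\;c_0\dfrac{r^3}{\lambda^5}\le E^x\tau_B\le2\lambda r^3$; (b) for each $K\ge0$, $\;q_{2t}(x_0,y)\le(1+\sqrt K)t^{-2/3}\lambda^3$ for all $t\in I$ and $y\in B(x_0,Kt^{1/3})$; (c) for $x\in B(x_0,r/\lambda)$, $\;q_{2t}(x,y)\ge c_1t^{-2/3}\lambda^{-17}$ whenever $d(x,y)\le c_2\lambda^{-19}r$ and $t\in I$.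
   Context: $\mathbb B$ is the rooted tree in which every vertex has $n_0\ge2$ children. On $\Gamma$: $\mu_{xy}=1$ for adjacent $x,y$ and $0$ otherwise, $\mu_x$ the degree of $x$ in $\Gamma$, $\mu(A)=\sum_{x\in A}\mu_x$, $d$ the graph distance in $\Gamma$, $B(x,r)=\{y\in\Gamma:d(x,y)\le r\}$, $V(x,r)=\mu(B(x,r))$. $Y$ is the continuous-time simple random walk on $\Gamma$ (exponential mean-1 holding times, jumps to a uniform neighbour) with law $P^x$ and expectation $E^x$, $q_t(x,y)=P^x(Y_t=y)/\mu_y$, $\tau_B=\inf\{t\ge0:Y_t\notin B\}$. $M(x,r)$ is the smallest $m$ such that there is $A=\{z_1,\dots,z_m\}\subset\Gamma$ with $d(x,z_i)\in[r/4,3r/4]$ for all $i$ such that every path in $\Gamma$ from $x$ to $\Gamma\setminus B(x,r)$ passes through $A$. The ball $B(x,r)$ is $\lambda$-good if: $x\in\Gamma$; $r^2\lambda^{-2}\le V(x,r)\le r^2\lambda$; $M(x,r)\le\lambda/64$; $V(x,r/\lambda)\ge r^2\lambda^{-4}$; $V(x,r/\lambda^2)\ge r^2\lambda^{-6}$. *)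

theory Defs
  imports "HOL-Analysis.Analysis" "HOL-Library.Extended_Nat"
begin

text \<open>The rooted tree in which every vertex has n0 children: vertices are finite words
over the alphabet {0..<n0}; the root is the empty word; the children of w are w @ [i].\<close>

definition tree_vertex :: "nat \<Rightarrow> nat list \<Rightarrow> bool" where
  "tree_vertex n0 w \<longleftrightarrow> (\<forall>i\<in>set w. i < n0)"

definition tree_adj :: "nat \<Rightarrow> nat list \<Rightarrow> nat list \<Rightarrow> bool" where
  "tree_adj n0 x y \<longleftrightarrow> tree_vertex n0 x \<and> tree_vertex n0 y \<and>
     (\<exists>i<n0. y = x @ [i] \<or> x = y @ [i])"

text \<open>Adjacency in the subgraph Gamma (vertex set G). A connected subgraph of a tree is
induced, so its edges are exactly the tree edges between its vertices.\<close>

definition adjG :: "nat \<Rightarrow> nat list set \<Rightarrow> nat list \<Rightarrow> nat list \<Rightarrow> bool" where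
  "adjG n0 G x y \<longleftrightarrow> x \<in> G \<and> y \<in> G \<and> tree_adj n0 x y"

definition connected_sub :: "nat \<Rightarrow> nat list set \<Rightarrow> bool" where
  "connected_sub n0 G \<longleftrightarrow> (\<forall>x\<in>G. \<forall>y\<in>G. (adjG n0 G)\<^sup>*\<^sup>* x y)"

definition deg :: "nat \<Rightarrow> nat list set \<Rightarrow> nat list \<Rightarrow> real" where
  "deg n0 G x = real (card {y. adjG n0 G x y})"

definition mu :: "nat \<Rightarrow> nat list set \<Rightarrow> nat list set \<Rightarrow> real" where
  "mu n0 G A = (\<Sum>x\<in>A. deg n0 G x)"

definition gdist :: "nat \<Rightarrow> nat list set \<Rightarrow> nat list \<Rightarrow> nat list \<Rightarrow> nat" where
  "gdist n0 G x y = (LEAST n. (adjG n0 G ^^ n) x y)"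

definition ball :: "nat \<Rightarrow> nat list set \<Rightarrow> nat list \<Rightarrow> real \<Rightarrow> nat list set" where
  "ball n0 G x r = {y \<in> G. real (gdist n0 G x y) \<le> r}"

definition vol :: "nat \<Rightarrow> nat list set \<Rightarrow> nat list \<Rightarrow> real \<Rightarrow> real" where
  "vol n0 G x r = mu n0 G (ball n0 G x r)"

definition Msep :: "nat \<Rightarrow> nat list set \<Rightarrow> nat list \<Rightarrow> real \<Rightarrow> enat" where
  "Msep n0 G x r = (INF A \<in> {A. finite A \<and> A \<subseteq> G \<and>
        (\<forall>z\<in>A. r/4 \<le> real (gdist n0 G x z) \<and> real (gdist n0 G x z) \<le> 3*r/4) \<and>
        \<not> (\<exists>y \<in> G - ball n0 G x r. (adjG n0 (G - A))\<^sup>*\<^sup>* x y)}. enat (card A))"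

definition good_ball :: "nat \<Rightarrow> nat list set \<Rightarrow> real \<Rightarrow> nat list \<Rightarrow> real \<Rightarrow> bool" where
  "good_ball n0 G lam x r \<longleftrightarrow> x \<in> G \<and>
     r\<^sup>2 / lam\<^sup>2 \<le> vol n0 G x r \<and> vol n0 G x r \<le> r\<^sup>2 * lam \<and>
     (\<exists>m. Msep n0 G x r = enat m \<and> real m \<le> lam / 64) \<and>
     vol n0 G x (r / lam) \<ge> r\<^sup>2 / lam ^ 4 \<and>
     vol n0 G x (r / lam\<^sup>2) \<ge> r\<^sup>2 / lam ^ 6"

fun pstep :: "nat \<Rightarrow> nat list set \<Rightarrow> nat \<Rightarrow> nat list \<Rightarrow> nat list \<Rightarrow> real" where
  "pstep n0 G 0 x y = (if x = y then 1 else 0)"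
| "pstep n0 G (Suc k) x y = (\<Sum>z\<in>{z. adjG n0 G x z}. pstep n0 G k z y / deg n0 G x)"

fun pstay :: "nat \<Rightarrow> nat list set \<Rightarrow> nat list set \<Rightarrow> nat \<Rightarrow> nat list \<Rightarrow> real" where
  "pstay n0 G B 0 x = (if x \<in> B then 1 else 0)"
| "pstay n0 G B (Suc k) x = (if x \<in> B then (\<Sum>z\<in>{z. adjG n0 G x z}. pstay n0 G B k z / deg n0 G x) else 0)"

text \<open>Continuous-time walk Y (exp(1) holding times) = jump chain run at the times of an
independent rate-1 Poisson process: P^x(Y_t = y) = sum_k e^{-t} t^k/k! p_k(x,y).\<close>
definition poisson_w :: "real \<Rightarrow> nat \<Rightarrow> real" where
  "poisson_w t k = exp (- t) * t ^ k / fact k"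

definition trans_prob :: "nat \<Rightarrow> nat list set \<Rightarrow> real \<Rightarrow> nat list \<Rightarrow> nat list \<Rightarrow> real" where
  "trans_prob n0 G t x y = (\<Sum>k. poisson_w t k * pstep n0 G k x y)"

definition q :: "nat \<Rightarrow> nat list set \<Rightarrow> real \<Rightarrow> nat list \<Rightarrow> nat list \<Rightarrow> real" where
  "q n0 G t x y = trans_prob n0 G t x y / deg n0 G y"

text \<open>P^x(tau_B > t) = sum_k P(N_t = k) P^x(jump chain in B at steps 0..k),
and E^x tau_B = integral over [0,oo) of P^x(tau_B > t) (possibly infinite).\<close>
definition surv :: "nat \<Rightarrow> nat list set \<Rightarrow> nat list set \<Rightarrow> nat list \<Rightarrow> real \<Rightarrow> real" where
  "surv n0 G B x t = (\<Sum>k. poisson_w t k * pstay n0 G B k x)"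

definition exit_time_mean :: "nat \<Rightarrow> nat list set \<Rightarrow> nat list set \<Rightarrow> nat list \<Rightarrow> ennreal" where
  "exit_time_mean n0 G B x = (\<integral>\<^sup>+ t. ennreal (surv n0 G B x t) * indicator {0..} t \<partial>lborel)"

end

theory Submission
  imports Defs "HOL-Library.Sublist" "HOL-Probability.Distributions"
begin

text \<open>Exit times. The expected exit time \<open>T\<close> from \<open>B\<close> solves \<open>-\<Delta>T = \<mu>\<close> on \<open>B\<close>. Pairing it with
  \<open>min(T, T(x))\<close>, whose energy is at least \<open>T(x)\<^sup>2 / d(x, B\<^sup>c)\<close>, gives \<open>T(x) \<le> d(x, B\<^sup>c) \<mu>(B)\<close>. Pairing it
  with the positive part of one minus the sum of the unit voltages from \<open>x\<close> to the points of a cutset,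
  which in a tree are explicit in terms of distances, gives a lower bound for \<open>T(x)\<close>.

  Heat kernel. The energy of \<open>q\<^sub>s(x, \<cdot>)\<close> is at most \<open>q\<^sub>s(x, x) / s\<close>, so Cauchy-Schwarz along a geodesic
  yields \<open>|q\<^sub>s(x, y) - q\<^sub>s(x, x)|\<^sup>2 \<le> d(x, y) q\<^sub>s(x, x) / s\<close>. Averaging over a ball of radius \<open>\<rho>\<close> turns this
  into \<open>q\<^sub>s(x, x) \<le> max(2 / V(x, \<rho>), 4\<rho> / s)\<close>. Conversely \<open>P\<^sup>x(\<tau>\<^sub>B > t) \<ge> (T(x) - t) / sup T\<close>, and
  \<open>P\<^sup>x(Y\<^sub>t \<in> B)\<^sup>2 \<le> \<mu>(B) q\<^sub>2\<^sub>t(x, x)\<close> bounds the diagonal from below.\<close>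

subsection \<open>Distance in subtrees\<close>

text \<open>The distance in the full tree, computed on words: the common prefix is stripped and the
  remaining lengths are added. \<open>gdist_eq_tdist\<close> identifies it with \<open>gdist\<close>
  on \<open>G\<close>.\<close>

fun tdist :: "nat list \<Rightarrow> nat list \<Rightarrow> nat" where
  "tdist [] ys = length ys"
| "tdist (x # xs) [] = Suc (length xs)"
| "tdist (x # xs) (y # ys) = (if x = y then tdist xs ys else length xs + length ys + 2)"

lemma tdist_self [simp]: "tdist x x = 0"
  by (induction x) auto

lemma tdist_eq_0_iff [simp]: "tdist x y = 0 \<longleftrightarrow> x = y"
  by (induction x y rule: tdist.induct) auto

lemma tdist_Nil_right [simp]: "tdist x [] = length x"
  by (cases x) auto

lemma tdist_commute: "tdist x y = tdist y x"
  by (induction x y rule: tdist.induct) auto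

lemma tdist_snoc_prefix: "prefix (y @ [i]) x \<Longrightarrow> tdist x y = Suc (tdist x (y @ [i]))"
  by (induction x y rule: tdist.induct) (auto simp: prefix_Cons)

lemma tdist_snoc_not_prefix: "\<not> prefix (y @ [i]) x \<Longrightarrow> tdist x (y @ [i]) = Suc (tdist x y)"
  by (induction x y rule: tdist.induct) (auto simp: prefix_Cons)

lemma adjG_commute: "adjG n0 G x y \<longleftrightarrow> adjG n0 G y x"
  unfolding adjG_def tree_adj_def by blast

lemma adjG_cases:
  assumes "adjG n0 G x y"
  obtains i where "y = x @ [i]" | i where "x = y @ [i]"
  using assms unfolding adjG_def tree_adj_def by blast

lemma adjG_tdist:
  assumes "adjG n0 G y z"
  shows "tdist x z = Suc (tdist x y) \<or> tdist x y = Suc (tdist x z)"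
  using assms by (rule adjG_cases) (metis tdist_snoc_prefix tdist_snoc_not_prefix)+

text \<open>The absence of cycles enters here. If \<open>y\<close> is a prefix of \<open>x\<close>,
  stepping closer means appending the next letter of \<open>x\<close>; otherwise it means deleting
  the last letter of \<open>y\<close>.\<close>

lemma adjG_closer_unique:
  assumes "adjG n0 G y a" "adjG n0 G y b" "tdist x a < tdist x y" "tdist x b < tdist x y"
  shows "a = b"
proof -
  have side: "prefix y x \<and> prefix c x \<and> length c = Suc (length y) \<or> \<not> prefix y x \<and> c = butlast y"
    if "adjG n0 G y c" "tdist x c < tdist x y" for c
    using that(1)
  proof (rule adjG_cases)
    fix i assume "c = y @ [i]"
    with that(2) tdist_snoc_not_prefix[of y i x] show ?thesis
      by (auto intro: append_prefixD)
  next
    fix i assume "y = c @ [i]"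
    with that(2) tdist_snoc_prefix[of c i x] show ?thesis by auto
  qed
  from side[OF assms(1,3)] side[OF assms(2,4)] show ?thesis
    by (metis prefix_length_prefix order_refl prefix_order.antisym)
qed

lemma finite_neighbours: "finite {y. adjG n0 G x y}"
proof (rule finite_subset)
  show "{y. adjG n0 G x y} \<subseteq> insert (butlast x) ((\<lambda>i. x @ [i]) ` {..<n0})"
    unfolding adjG_def tree_adj_def by auto
qed auto

section \<open>Graph distance in an infinite subtree\<close>

locale infinite_subtree =
  fixes n0 :: nat and G :: "nat list set"
  assumes infinite: "infinite G" and connected: "connected_sub n0 G"
begin

abbreviation adj :: "nat list \<Rightarrow> nat list \<Rightarrow> bool" where "adj \<equiv> adjG n0 G"
abbreviation nb :: "nat list \<Rightarrow> nat list set" where "nb x \<equiv> {y. adj x y}"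

lemma adj_in: assumes "adj x y" shows "x \<in> G" "y \<in> G"
  using assms by (auto simp: adjG_def)

lemma relpowp_tdist_le: "(adj ^^ n) x y \<Longrightarrow> tdist x y \<le> n"
proof (induction n arbitrary: y)
  case (Suc n)
  then obtain z where "(adj ^^ n) x z" "adj z y" by auto
  with Suc.IH adjG_tdist[of n0 G z y x] show ?case by fastforce
qed auto

text \<open>A walk in \<open>G\<close> shortens to the tree geodesic without leaving
  \<open>G\<close>. If its last edge leads back towards \<open>x\<close>, then by
  \<open>adjG_closer_unique\<close> it ends at the predecessor of \<open>z\<close> on the
  geodesic.\<close>

lemma relpowp_tdist: "(adj ^^ n) x y \<Longrightarrow> (adj ^^ tdist x y) x y"
proof (induction n arbitrary: y)
  case (Suc n)
  then obtain z where z: "(adj ^^ tdist x z) x z" "adj z y" by auto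
  consider "tdist x y = Suc (tdist x z)" | "tdist x z = Suc (tdist x y)"
    using adjG_tdist z(2) by blast
  then show ?case
  proof cases
    case 1
    with z show ?thesis by auto
  next
    case 2
    with z(1) obtain u where u: "(adj ^^ tdist x y) x u" "adj u z" by auto
    then have "tdist x u \<le> tdist x y" by (simp add: relpowp_tdist_le)
    then have "u = y"
      using adjG_closer_unique[of n0 G z u y x] u(2) z(2) 2 by (simp add: adjG_commute)
    with u show ?thesis by simp
  qed
qed auto

lemma relpowp_adj:
  assumes "x \<in> G" "y \<in> G" shows "(adj ^^ tdist x y) x y"
proof -
  have "adj\<^sup>*\<^sup>* x y" using assms connected unfolding connected_sub_def by blast
  then show ?thesis using relpowp_tdist by (auto dest: rtranclp_imp_relpowp)
qed

lemma gdist_eq_tdist: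
  assumes "x \<in> G" "y \<in> G" shows "gdist n0 G x y = tdist x y"
  unfolding gdist_def using relpowp_adj[OF assms] relpowp_tdist_le by (rule Least_equality)

lemma tdist_triangle:
  assumes "x \<in> G" "y \<in> G" "z \<in> G" shows "tdist x z \<le> tdist x y + tdist y z"
  using relpowp_adj[of x y] relpowp_adj[of y z] assms
  by (intro relpowp_tdist_le) (auto simp: relpowp_add)

lemma closer_neighbour:
  assumes "x \<in> G" "y \<in> G" "x \<noteq> y"
  obtains z where "adj z y" "tdist x y = Suc (tdist x z)"
proof -
  obtain n where n: "tdist x y = Suc n" using assms(3) by (metis tdist_eq_0_iff not0_implies_Suc)
  then obtain z where z: "(adj ^^ n) x z" "adj z y" using relpowp_adj[OF assms(1,2)] by auto
  with relpowp_tdist_le adjG_tdist[of n0 G z y x] n have "tdist x y = Suc (tdist x z)" by fastforce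
  with z that show ?thesis by blast
qed

lemma finite_tball:
  assumes "x \<in> G" shows "finite {y \<in> G. tdist x y \<le> n}"
proof (induction n)
  case 0
  show ?case by (rule finite_subset[of _ "{x}"]) auto
next
  case (Suc n)
  have "{y \<in> G. tdist x y \<le> Suc n} \<subseteq> insert x (\<Union>z\<in>{y \<in> G. tdist x y \<le> n}. nb z)"
  proof
    fix y assume y: "y \<in> {y \<in> G. tdist x y \<le> Suc n}"
    show "y \<in> insert x (\<Union>z\<in>{y \<in> G. tdist x y \<le> n}. nb z)"
    proof (cases "x = y")
      case False
      then obtain z where "adj z y" "tdist x y = Suc (tdist x z)" using closer_neighbour assms y by blast
      with y show ?thesis by (auto simp: adjG_def)
    qed auto
  qed
  moreover have "finite (insert x (\<Union>z\<in>{y \<in> G. tdist x y \<le> n}. nb z))"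
    using Suc finite_neighbours by blast
  ultimately show ?case by (rule finite_subset)
qed

lemma ball_eq:
  assumes "x \<in> G" shows "ball n0 G x r = {y \<in> G. real (tdist x y) \<le> r}"
  unfolding ball_def using assms by (auto simp: gdist_eq_tdist)

lemma finite_ball: assumes "x \<in> G" shows "finite (ball n0 G x r)"
  by (rule finite_subset[OF _ finite_tball[OF assms, of "nat \<lfloor>r\<rfloor>"]])
     (auto simp: ball_eq[OF assms] le_nat_floor)

text \<open>Balls are finite and \<open>G\<close> is not, so some \<open>v\<close> lies farther than
  \<open>n\<close>; walking back from \<open>v\<close> towards \<open>x\<close> meets every smaller
  distance.\<close>

lemma sphere_nonempty:
  assumes "x \<in> G" obtains y where "y \<in> G" "tdist x y = n"
proof -
  obtain v where v: "v \<in> G" "\<not> tdist x v \<le> n"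
    using finite_tball[OF assms, of n] infinite by (metis (mono_tags, lifting) finite_subset mem_Collect_eq subsetI)
  \<comment> \<open>Subtraction on naturals is truncated: once the walk reaches \<open>x\<close> it
    stays there.\<close>
  have "\<exists>y\<in>G. tdist x y = tdist x v - k" for k
  proof (induction k)
    case 0
    show ?case using v by auto
  next
    case (Suc k)
    then obtain y where y: "y \<in> G" "tdist x y = tdist x v - k" by blast
    show ?case
    proof (cases "x = y")
      case True
      with y show ?thesis by (intro bexI[of _ y]) auto
    next
      case False
      then obtain z where "adj z y" "tdist x y = Suc (tdist x z)" using closer_neighbour assms y(1) by blast
      with y show ?thesis by (intro bexI[of _ z]) (auto simp: adjG_def)
    qed
  qed
  from this[of "tdist x v - n"] v that show ?thesis by auto
qed

lemma deg_ge_1: assumes "x \<in> G" shows "deg n0 G x \<ge> 1"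
proof -
  obtain y where "y \<in> G" "tdist x y = 1" using sphere_nonempty[OF assms] by blast
  then obtain z where "adj z x" using closer_neighbour[of y x] assms by (metis tdist_self zero_neq_one)
  then have "z \<in> nb x" using adjG_commute by blast
  then have "card (nb x) \<noteq> 0" using finite_neighbours[of n0 G x] by auto
  then show ?thesis unfolding deg_def by linarith
qed

lemma deg_nonneg: "deg n0 G x \<ge> 0"
  by (simp add: deg_def)

subsection \<open>The graph Laplacian and its energy\<close>

text \<open>The sign makes this the positive operator, minus Delta. With \<open>avg\<close> as the
  transition operator P it is the degree times I - P.\<close>

definition lap :: "(nat list \<Rightarrow> real) \<Rightarrow> nat list \<Rightarrow> real" where
  "lap f a = (\<Sum>b\<in>nb a. f a - f b)"

definition avg :: "(nat list \<Rightarrow> real) \<Rightarrow> nat list \<Rightarrow> real" where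
  "avg f a = (\<Sum>b\<in>nb a. f b) / deg n0 G a"

text \<open>Ordered pairs: each edge meeting \<open>S\<close> appears in both orientations, whence
  the division by 2 in \<open>green_formula\<close>.\<close>

definition touching :: "nat list set \<Rightarrow> (nat list \<times> nat list) set" where
  "touching S = {(a, b). adj a b \<and> (a \<in> S \<or> b \<in> S)}"

lemma lap_eq_avg: "lap f a = deg n0 G a * (f a - avg f a)"
proof (cases "nb a = {}")
  case False
  then have "deg n0 G a \<noteq> 0" using finite_neighbours[of n0 G a] by (simp add: deg_def)
  then show ?thesis
    by (simp add: lap_def avg_def sum_subtractf deg_def right_diff_distrib)
qed (simp add: lap_def deg_def)

lemma finite_touching:
  assumes "finite S" shows "finite (touching S)"
proof -
  have "touching S \<subseteq> Sigma S nb \<union> (\<lambda>(a, b). (b, a)) ` Sigma S nb"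
    using adjG_commute by (force simp: touching_def)
  moreover have "finite (Sigma S nb)" using assms finite_neighbours by blast
  ultimately show ?thesis by (meson finite_UnI finite_imageI finite_subset)
qed

lemma sum_touching_swap: "(\<Sum>(a, b)\<in>touching S. F a b) = (\<Sum>(a, b)\<in>touching S. F b a)"
  by (rule sum.reindex_bij_witness[of _ prod.swap prod.swap])
     (auto simp: touching_def adjG_commute)

text \<open>Since \<open>f\<close> vanishes off \<open>S\<close>, the left side extends to all
  touching pairs; averaging with the sum over swapped pairs gives the symmetric form.\<close>

lemma green_formula:
  assumes "finite S" and f: "\<And>a. a \<notin> S \<Longrightarrow> f a = 0"
  shows "(\<Sum>a\<in>S. f a * lap g a) = (\<Sum>(a, b)\<in>touching S. (f a - f b) * (g a - g b)) / 2"
proof -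
  have f': "f a \<noteq> 0 \<Longrightarrow> a \<in> S" for a using f by blast
  have "(\<Sum>a\<in>S. f a * lap g a) = (\<Sum>(a, b)\<in>Sigma S nb. f a * (g a - g b))"
    using assms(1) finite_neighbours by (simp add: lap_def sum_distrib_left sum.Sigma)
  also have "\<dots> = (\<Sum>(a, b)\<in>touching S. f a * (g a - g b))"
    using finite_touching[OF assms(1)]
    by (intro sum.mono_neutral_left) (auto simp: touching_def dest: f')
  finally have 1: "(\<Sum>a\<in>S. f a * lap g a) = (\<Sum>(a, b)\<in>touching S. f a * (g a - g b))" .
  have 2: "\<dots> = (\<Sum>(a, b)\<in>touching S. f b * (g b - g a))"
    by (rule sum_touching_swap)
  have "(\<Sum>(a, b)\<in>touching S. (f a - f b) * (g a - g b))
      = (\<Sum>(a, b)\<in>touching S. f a * (g a - g b)) + (\<Sum>(a, b)\<in>touching S. f b * (g b - g a))"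
    unfolding sum.distrib[symmetric] by (rule sum.cong) (auto simp: algebra_simps)
  then show ?thesis using 1 2 by simp
qed

lemma lap_symmetric:
  assumes "finite S" "\<And>a. a \<notin> S \<Longrightarrow> f a = 0" "\<And>a. a \<notin> S \<Longrightarrow> g a = 0"
  shows "(\<Sum>a\<in>S. f a * lap g a) = (\<Sum>a\<in>S. g a * lap f a)"
  using green_formula[of S f g, OF assms(1,2)] green_formula[of S g f, OF assms(1,3)]
  by (simp add: mult.commute)

section \<open>Energy along geodesics\<close>

lemma geodesic_edges:
  assumes "x \<in> G" "y \<in> G"
  obtains P where "finite P" "card P = tdist x y"
    "\<And>a b. (a, b) \<in> P \<Longrightarrow> adj a b \<and> tdist x b = Suc (tdist x a)"
    "\<And>f :: nat list \<Rightarrow> real. f y - f x = (\<Sum>(a, b)\<in>P. f b - f a)"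
proof -
  \<comment> \<open>The invariant \<open>tdist x b \<le> n\<close> guarantees that the edge added at
    level n + 1 is new.\<close>
  have "\<exists>P. finite P \<and> card P = n \<and>
      (\<forall>(a, b)\<in>P. adj a b \<and> tdist x b = Suc (tdist x a) \<and> tdist x b \<le> n) \<and>
      (\<forall>f :: nat list \<Rightarrow> real. f y - f x = (\<Sum>(a, b)\<in>P. f b - f a))"
    if "y \<in> G" "tdist x y = n" for n y
    using that
  proof (induction n arbitrary: y)
    case 0
    then show ?case by (intro exI[of _ "{}"]) auto
  next
    case (Suc n)
    then have "x \<noteq> y" by auto
    then obtain z where z: "adj z y" "tdist x y = Suc (tdist x z)"
      using closer_neighbour assms(1) Suc.prems(1) by blast
    with Suc have "z \<in> G" "tdist x z = n" by (auto simp: adjG_def)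
    from Suc.IH[OF this] obtain P where P: "finite P" "card P = n"
      "\<forall>(a, b)\<in>P. adj a b \<and> tdist x b = Suc (tdist x a) \<and> tdist x b \<le> n"
      "\<forall>f :: nat list \<Rightarrow> real. f z - f x = (\<Sum>(a, b)\<in>P. f b - f a)" by blast
    have "(z, y) \<notin> P" using P(3) Suc.prems(2) by auto
    have "f y - f x = (\<Sum>(a, b)\<in>insert (z, y) P. f b - f a)" for f :: "nat list \<Rightarrow> real"
      using P(1) P(4)[rule_format, of f] \<open>(z, y) \<notin> P\<close> by simp
    then show ?case
      using P(1-3) \<open>(z, y) \<notin> P\<close> z Suc.prems(2)
      by (intro exI[of _ "insert (z, y) P"]) auto
  qed
  from this[OF assms(2) refl] that show ?thesis by (auto; blast)
qed

text \<open>Effective resistance is at most distance: Cauchy-Schwarz on the telescoping sum along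
  the geodesic, whose edges carry only part of the energy.\<close>

lemma diff_sq_le_energy:
  assumes "finite S" and f: "\<And>a. a \<notin> S \<Longrightarrow> f a = 0" and "x \<in> G" "y \<in> G"
  shows "(f y - f x)\<^sup>2 \<le> tdist x y * (\<Sum>a\<in>S. f a * lap f a)"
proof -
  obtain P where P: "finite P" "card P = tdist x y"
    "\<And>a b. (a, b) \<in> P \<Longrightarrow> adj a b \<and> tdist x b = Suc (tdist x a)"
    "\<And>f :: nat list \<Rightarrow> real. f y - f x = (\<Sum>(a, b)\<in>P. f b - f a)"
    using geodesic_edges[OF assms(3,4)] by blast
  define D where "D = (\<lambda>(a, b). (f a - f b)\<^sup>2)"
  define P' where "P' = P \<inter> touching S"
  have "(f y - f x)\<^sup>2 = (\<Sum>e\<in>P. f (snd e) - f (fst e))\<^sup>2"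
    using P(4)[of f] by (simp add: case_prod_beta)
  also have "\<dots> \<le> (\<Sum>e\<in>P. (f (snd e) - f (fst e))\<^sup>2) * card P"
    by (rule sum_squared_le_sum_of_squares)
  also have "(\<Sum>e\<in>P. (f (snd e) - f (fst e))\<^sup>2) = sum D P"
    by (simp add: D_def case_prod_beta power2_commute)
  also have "sum D P = sum D P'"
    using P(1,3) f by (intro sum.mono_neutral_right) (force simp: P'_def D_def touching_def)+
  finally have 1: "(f y - f x)\<^sup>2 \<le> sum D P' * tdist x y" using P(2) by simp
  \<comment> \<open>The energy counts ordered pairs, so each geodesic edge is also taken reversed.
    The two families are disjoint because edges of \<open>P\<close> point away from
    \<open>x\<close>.\<close>
  have "2 * sum D P' = sum D P' + sum D (prod.swap ` P')"
    by (subst sum.reindex) (auto simp: D_def case_prod_beta power2_commute inj_on_def)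
  also have "\<dots> = sum D (P' \<union> prod.swap ` P')"
  proof (rule sum.union_disjoint[symmetric])
    show "P' \<inter> prod.swap ` P' = {}" 
    proof (rule equals0I)
      fix e assume "e \<in> P' \<inter> prod.swap ` P'"
      then obtain a b where "(a, b) \<in> P" "(b, a) \<in> P" by (auto simp: P'_def)
      with P(3)[of a b] P(3)[of b a] show False by simp
    qed
  qed (use P(1) in \<open>auto simp: P'_def\<close>)
  also have "\<dots> \<le> sum D (touching S)"
    using finite_touching[OF assms(1)] adjG_commute
    by (intro sum_mono2) (auto simp: P'_def D_def touching_def)
  also have "\<dots> = 2 * (\<Sum>a\<in>S. f a * lap f a)"
    using green_formula[of S f f, OF assms(1) f] by (simp add: D_def power2_eq_square)
  finally have "sum D P' \<le> (\<Sum>a\<in>S. f a * lap f a)" by simp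
  then have "sum D P' * tdist x y \<le> (\<Sum>a\<in>S. f a * lap f a) * tdist x y"
    by (rule mult_right_mono) simp
  with 1 show ?thesis by (simp add: mult.commute)
qed

end

subsection \<open>Poisson averages\<close>

lemma poisson_w_nonneg: "t \<ge> 0 \<Longrightarrow> poisson_w t k \<ge> 0"
  by (simp add: poisson_w_def)

lemma poisson_w_sums: "poisson_w t sums 1"
proof -
  have "(\<lambda>k. exp (- t) * (t ^ k /\<^sub>R fact k)) sums (exp (- t) * exp t)"
    by (intro sums_mult exp_converges)
  then show ?thesis by (simp add: poisson_w_def[abs_def] exp_minus field_simps)
qed

lemma poisson_w_mean_sums: "(\<lambda>k. poisson_w t k * real k) sums t"
proof -
  have "poisson_w t (Suc k) * real (Suc k) = t * poisson_w t k" for k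
    by (simp add: poisson_w_def field_simps del: of_nat_Suc)
  then have "(\<lambda>k. poisson_w t (Suc k) * real (Suc k)) sums t"
    using sums_mult[OF poisson_w_sums, of t t] by simp
  then show ?thesis by (subst (asm) sums_Suc_iff) simp
qed

lemma poisson_w_add:
  "(\<Sum>j\<le>n. poisson_w s j * poisson_w t (n - j)) = poisson_w (s + t) n"
proof -
  have "(\<Sum>j\<le>n. poisson_w s j * poisson_w t (n - j))
      = (\<Sum>j\<le>n. exp (- (s + t)) / fact n * (of_nat (n choose j) * s ^ j * t ^ (n - j)))"
  proof (rule sum.cong)
    fix j assume "j \<in> {..n}"
    moreover have "exp (- s) * exp (- t) = exp (- (s + t))" by (simp add: mult_exp_exp)
    ultimately show "poisson_w s j * poisson_w t (n - j)
        = exp (- (s + t)) / fact n * (of_nat (n choose j) * s ^ j * t ^ (n - j))"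
      by (simp add: poisson_w_def binomial_fact field_simps)
  qed simp
  also have "\<dots> = poisson_w (s + t) n"
    by (simp add: poisson_w_def binomial_ring sum_distrib_left sum_divide_distrib)
  finally show ?thesis .
qed

text \<open>The expectation of \<open>b\<close> at a Poisson time of mean \<open>t\<close>. The heat
  kernel has this form with bounded \<open>b\<close>, so calculus in \<open>t\<close> reduces to
  differences in \<open>k\<close>.\<close>

definition pavg :: "real \<Rightarrow> (nat \<Rightarrow> real) \<Rightarrow> real" where
  "pavg t b = (\<Sum>k. poisson_w t k * b k)"

lemma pavg_sums:
  assumes "\<And>k. \<bar>b k\<bar> \<le> M"
  shows "(\<lambda>k. poisson_w t k * b k) sums pavg t b"
  unfolding pavg_def
proof (rule summable_sums)
  have "summable (\<lambda>k. exp (- t) * (norm (t ^ k /\<^sub>R fact k) * M))"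
    by (intro summable_mult summable_mult2 summable_norm_exp)
  moreover have "norm (poisson_w t k * b k) \<le> exp (- t) * (norm (t ^ k /\<^sub>R fact k) * M)" for k
  proof -
    have "norm (poisson_w t k * b k) = exp (- t) * (norm (t ^ k /\<^sub>R fact k) * \<bar>b k\<bar>)"
      by (simp add: poisson_w_def abs_mult divide_inverse mult_ac)
    then show ?thesis using assms[of k] by (simp add: mult_left_mono)
  qed
  ultimately show "summable (\<lambda>k. poisson_w t k * b k)"
    by (rule summable_comparison_test'[where N = 0])
qed

lemma pavg_minus:
  assumes "\<And>k. \<bar>b k\<bar> \<le> M"
  shows "pavg t (\<lambda>k. - b k) = - pavg t b"
proof -
  have "(\<lambda>k. - (poisson_w t k * b k)) sums - pavg t b"
    by (intro sums_minus pavg_sums[of b M] assms)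
  then show ?thesis by (simp add: pavg_def[of t "\<lambda>k. - b k"] sums_iff)
qed

text \<open>The average is \<open>exp (- t)\<close> times a power series: termwise differentiation
  shifts the coefficients, and the exponential contributes the subtracted term.\<close>

lemma pavg_has_derivative:
  assumes b: "\<And>k. \<bar>b k\<bar> \<le> M"
  shows "((\<lambda>t. pavg t b) has_real_derivative pavg t (\<lambda>k. b (Suc k) - b k)) (at t)"
proof -
  define c where "c k = b k / fact k" for k
  have sm: "summable (\<lambda>k. c k * x ^ k)" for x
  proof -
    have "summable (\<lambda>k. exp x * (poisson_w x k * b k))"
      using pavg_sums[of b M x, OF b] by (intro summable_mult) (rule sums_summable)
    then show ?thesis by (simp add: poisson_w_def c_def exp_minus field_simps)
  qed
  have pavg_c: "pavg x b = exp (- x) * (\<Sum>k. c k * x ^ k)" for x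
    using suminf_mult[OF sm, of "exp (- x)" x]
    by (simp add: pavg_def poisson_w_def c_def field_simps)
  have diffs_c: "diffs c k = b (Suc k) / fact k" for k
    by (simp add: diffs_def c_def field_simps del: of_nat_Suc)
  have D: "((\<lambda>x. \<Sum>k. c k * x ^ k) has_real_derivative (\<Sum>k. diffs c k * t ^ k)) (at t)"
    by (rule termdiffs_strong_converges_everywhere[OF sm])
  have sm': "summable (\<lambda>k. diffs c k * t ^ k)"
    by (rule termdiff_converges_all[OF sm])
  have "((\<lambda>x. exp (- x) * (\<Sum>k. c k * x ^ k)) has_real_derivative
      exp (- t) * ((\<Sum>k. diffs c k * t ^ k) - (\<Sum>k. c k * t ^ k))) (at t)"
    by (rule derivative_eq_intros D refl | simp add: algebra_simps)+
  also have "exp (- t) * ((\<Sum>k. diffs c k * t ^ k) - (\<Sum>k. c k * t ^ k))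
      = (\<Sum>k. exp (- t) * (diffs c k * t ^ k - c k * t ^ k))"
    using sm sm' by (simp add: suminf_diff suminf_mult summable_diff)
  also have "\<dots> = pavg t (\<lambda>k. b (Suc k) - b k)"
    by (simp add: pavg_def poisson_w_def diffs_c c_def diff_divide_distrib algebra_simps)
  finally show ?thesis by (simp add: pavg_c[abs_def])
qed

text \<open>The sum of two independent Poisson variables of mean s is Poisson of mean 2s. This turns
  truncated quadratic forms in the kernel at time s into diagonal values at time 2s.\<close>

lemma pavg_double_limit:
  assumes s: "s \<ge> 0" and b: "\<And>k. \<bar>b k\<bar> \<le> M"
  shows "(\<lambda>N. \<Sum>j\<le>N. \<Sum>k\<le>N. poisson_w s j * poisson_w s k * b (j + k)) \<longlonglongrightarrow> pavg (2 * s) b"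
proof -
  define w where "w = poisson_w s"
  define Sq where "Sq N = {..N} \<times> {..N::nat}" for N
  define Tr where "Tr N = {(j, k). j + k \<le> (N::nat)}" for N
  have w0: "w k \<ge> 0" for k using poisson_w_nonneg[OF s] by (simp add: w_def)
  have fin: "finite (Sq N)" and sub: "Tr N \<subseteq> Sq N" for N by (auto simp: Sq_def Tr_def)
  have tr: "(\<Sum>(j, k)\<in>Tr N. w j * w k * c (j + k)) = (\<Sum>n\<le>N. poisson_w (2 * s) n * c n)" for N c
  proof -
    have "(\<Sum>(j, k)\<in>Tr N. w j * w k * c (j + k)) = (\<Sum>n\<le>N. \<Sum>j\<le>n. w j * w (n - j) * c (j + (n - j)))"
      unfolding Tr_def by (rule sum.triangle_reindex_eq)
    also have "\<dots> = (\<Sum>n\<le>N. (\<Sum>j\<le>n. w j * w (n - j)) * c n)"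
      by (simp add: sum_distrib_right)
    also have "\<dots> = (\<Sum>n\<le>N. poisson_w (2 * s) n * c n)"
      using poisson_w_add[where s = s and t = s] by (simp add: w_def)
    finally show ?thesis .
  qed
  \<comment> \<open>Square and triangular partial sums differ only on pairs of the square with j + k
    > N, whose mass tends to 1 * 1 - 1 = 0.\<close>
  have bound: "\<bar>(\<Sum>(j, k)\<in>Sq N. w j * w k * b (j + k)) - (\<Sum>n\<le>N. poisson_w (2 * s) n * b n)\<bar>
      \<le> M * ((\<Sum>j\<le>N. w j) * (\<Sum>j\<le>N. w j) - (\<Sum>n\<le>N. poisson_w (2 * s) n))" for N
  proof -
    have "(\<Sum>(j, k)\<in>Sq N. w j * w k * b (j + k)) - (\<Sum>n\<le>N. poisson_w (2 * s) n * b n)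
        = (\<Sum>(j, k)\<in>Sq N - Tr N. w j * w k * b (j + k))"
      unfolding tr[symmetric] using fin sub by (simp add: sum_diff)
    also have "\<bar>\<dots>\<bar> \<le> (\<Sum>(j, k)\<in>Sq N - Tr N. w j * w k * M)"
      by (rule order_trans[OF sum_abs]) (auto intro!: sum_mono mult_left_mono simp: abs_mult w0 b)
    also have "\<dots> = (\<Sum>(j, k)\<in>Sq N. w j * w k * M) - (\<Sum>(j, k)\<in>Tr N. w j * w k * M)"
      using fin sub by (simp add: sum_diff)
    also have "(\<Sum>(j, k)\<in>Tr N. w j * w k * M) = (\<Sum>n\<le>N. poisson_w (2 * s) n) * M"
      using tr[of "\<lambda>_. M"] by (simp add: sum_distrib_right)
    also have "(\<Sum>(j, k)\<in>Sq N. w j * w k * M) = (\<Sum>j\<le>N. w j) * (\<Sum>j\<le>N. w j) * M"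
      unfolding Sq_def sum.cartesian_product[symmetric] sum_product by (simp add: sum_distrib_right)
    finally show ?thesis by (simp add: algebra_simps)
  qed
  have lim1: "(\<lambda>N. \<Sum>j\<le>N. poisson_w u j) \<longlonglongrightarrow> 1" for u
    using poisson_w_sums[of u] by (simp add: sums_def_le)
  have "(\<lambda>N. M * ((\<Sum>j\<le>N. w j) * (\<Sum>j\<le>N. w j) - (\<Sum>n\<le>N. poisson_w (2 * s) n))) \<longlonglongrightarrow> M * (1 * 1 - 1)"
    unfolding w_def by (intro tendsto_intros lim1)
  then have "(\<lambda>N. (\<Sum>(j, k)\<in>Sq N. w j * w k * b (j + k)) - (\<Sum>n\<le>N. poisson_w (2 * s) n * b n)) \<longlonglongrightarrow> 0"
    by (intro Lim_null_comparison[OF always_eventually[OF allI[OF bound[folded real_norm_def]]]]) simp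
  from tendsto_add[OF this pavg_sums[of b M "2 * s", OF b, unfolded sums_def_le]]
  have "(\<lambda>N. \<Sum>(j, k)\<in>Sq N. w j * w k * b (j + k)) \<longlonglongrightarrow> pavg (2 * s) b"
    by (simp only: diff_add_cancel add_0)
  then show ?thesis unfolding Sq_def w_def sum.cartesian_product[symmetric] .
qed

subsection \<open>The heat kernel\<close>

lemma pstep_nonneg: "pstep n0 G k x y \<ge> 0"
  by (induction k arbitrary: x) (auto intro!: sum_nonneg simp: deg_def)

lemma sum_pstep_le_1:
  assumes "finite S" shows "(\<Sum>y\<in>S. pstep n0 G k x y) \<le> 1"
proof (induction k arbitrary: x)
  case 0
  have "(\<Sum>y\<in>S. pstep n0 G 0 x y) = (if x \<in> S then 1 else 0)" using assms by simp
  then show ?case by simp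
next
  case (Suc k)
  have "(\<Sum>y\<in>S. pstep n0 G (Suc k) x y) = (\<Sum>z | adjG n0 G x z. (\<Sum>y\<in>S. pstep n0 G k z y) / deg n0 G x)"
    by (simp add: sum.swap[of _ S] sum_divide_distrib)
  also have "\<dots> \<le> (\<Sum>z | adjG n0 G x z. 1 / deg n0 G x)"
    by (intro sum_mono divide_right_mono Suc) (simp add: deg_def)
  \<comment> \<open>At a vertex with no neighbours the sum is empty, so in general only an
    inequality holds.\<close>
  also have "\<dots> \<le> 1" by (simp add: deg_def)
  finally show ?case .
qed

lemma pstep_le_1: "pstep n0 G k x y \<le> 1"
  using sum_pstep_le_1[of "{y}"] by simp

lemma trans_prob_sums: "(\<lambda>k. poisson_w t k * pstep n0 G k x y) sums trans_prob n0 G t x y"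
  using pavg_sums[of "\<lambda>k. pstep n0 G k x y" 1 t]
  by (simp add: trans_prob_def pavg_def pstep_nonneg pstep_le_1)

lemma sum_trans_prob_le_1:
  assumes "finite S" "t \<ge> 0" shows "(\<Sum>y\<in>S. trans_prob n0 G t x y) \<le> 1"
proof (rule sums_le)
  show "(\<lambda>k. \<Sum>y\<in>S. poisson_w t k * pstep n0 G k x y) sums (\<Sum>y\<in>S. trans_prob n0 G t x y)"
    by (intro sums_sum trans_prob_sums)
  show "poisson_w t sums 1" by (rule poisson_w_sums)
  show "(\<Sum>y\<in>S. poisson_w t k * pstep n0 G k x y) \<le> poisson_w t k" for k
    using mult_left_mono[OF sum_pstep_le_1[OF assms(1), of n0 G k x] poisson_w_nonneg[OF assms(2), of k]]
    by (simp add: sum_distrib_left)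
qed

lemma sum_bilinear:
  fixes u v :: "nat \<Rightarrow> 'a \<Rightarrow> real"
  shows "(\<Sum>a\<in>S. (\<Sum>j\<le>N. c j * u j a) * (\<Sum>k\<le>N. c k * v k a))
       = (\<Sum>j\<le>N. \<Sum>k\<le>N. c j * c k * (\<Sum>a\<in>S. u j a * v k a))"
proof -
  have "(\<Sum>a\<in>S. (\<Sum>j\<le>N. c j * u j a) * (\<Sum>k\<le>N. c k * v k a))
      = (\<Sum>a\<in>S. \<Sum>j\<le>N. \<Sum>k\<le>N. c j * c k * (u j a * v k a))"
    unfolding sum_product by (intro sum.cong refl) (simp add: mult_ac)
  also have "\<dots> = (\<Sum>j\<le>N. \<Sum>k\<le>N. \<Sum>a\<in>S. c j * c k * (u j a * v k a))"
    by (subst sum.swap, rule sum.cong[OF refl], subst sum.swap, rule refl)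
  finally show ?thesis by (simp add: sum_distrib_left)
qed

context infinite_subtree
begin

text \<open>\<open>hk x k y\<close> is \<open>p\<^sub>k(y, x) / \<mu>\<^sub>x\<close>, with starting point \<open>y\<close>: \<open>pstep\<close> recurses on its starting point,
  so in this order one more step is one application of \<open>avg\<close>. By reversibility the order is immaterial.\<close>

definition hk :: "nat list \<Rightarrow> nat \<Rightarrow> nat list \<Rightarrow> real" where
  "hk x k y = pstep n0 G k y x / deg n0 G x"

lemma hk_0: "hk x 0 y = (if y = x then 1 / deg n0 G x else 0)"
  by (simp add: hk_def)

lemma hk_Suc: "hk x (Suc k) y = avg (hk x k) y"
  by (simp add: hk_def avg_def sum_divide_distrib divide_divide_eq_left mult.commute)

lemma hk_nonneg: "hk x k y \<ge> 0"
  by (simp add: hk_def pstep_nonneg deg_nonneg)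

lemma hk_le_1: "x \<in> G \<Longrightarrow> hk x k y \<le> 1"
  using pstep_le_1[of n0 G k y x] deg_ge_1[of x] by (simp add: hk_def field_simps)

lemma abs_hk_le_1: "x \<in> G \<Longrightarrow> \<bar>hk x k y\<bar> \<le> 1"
  by (simp add: hk_nonneg hk_le_1)

lemma hk_support:
  assumes "x \<in> G" "hk x k y \<noteq> 0" shows "y \<in> G \<and> tdist x y \<le> k"
  using assms(2)
proof (induction k arbitrary: y)
  case 0
  then show ?case using assms(1) by (auto simp: hk_0 split: if_splits)
next
  case (Suc k)
  then obtain z where z: "adj y z" "hk x k z \<noteq> 0"
    unfolding hk_Suc avg_def by (metis (mono_tags, lifting) divide_eq_0_iff mem_Collect_eq sum.neutral)
  with Suc.IH adjG_tdist[of n0 G y z x] show ?case by (fastforce simp: adjG_def)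
qed

text \<open>Reversibility: P is self-adjoint for the degree measure, because the diagonal terms on
  the two sides of \<open>lap_symmetric\<close> cancel.\<close>

lemma avg_symmetric:
  assumes "finite S" "\<And>a. a \<notin> S \<Longrightarrow> f a = 0" "\<And>a. a \<notin> S \<Longrightarrow> g a = 0"
  shows "(\<Sum>a\<in>S. deg n0 G a * avg f a * g a) = (\<Sum>a\<in>S. deg n0 G a * f a * avg g a)"
  using lap_symmetric[of S f g, OF assms]
  by (simp add: lap_eq_avg right_diff_distrib sum_subtractf algebra_simps)

text \<open>Chapman-Kolmogorov: self-adjointness moves the \<open>j\<close> averages one at a time
  to the second factor, leaving a point mass at \<open>x\<close>. \<open>S\<close> must contain all
  intermediate supports, hence the bound \<open>n\<close> on the total number of steps.\<close>

lemma hk_dot: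
  assumes "finite S" "x \<in> S"
    and "\<And>i a. i \<le> n \<Longrightarrow> a \<notin> S \<Longrightarrow> hk x i a = 0"
    and "\<And>i a. i \<le> n \<Longrightarrow> a \<notin> S \<Longrightarrow> hk y i a = 0"
    and "x \<in> G" "j + k \<le> n"
  shows "(\<Sum>a\<in>S. deg n0 G a * hk x j a * hk y k a) = hk y (j + k) x"
  using assms(6)
proof (induction j arbitrary: k)
  case 0
  have "(\<Sum>a\<in>S. deg n0 G a * hk x 0 a * hk y k a) = (\<Sum>a\<in>S. if a = x then hk y k x else 0)"
    using deg_ge_1[OF \<open>x \<in> G\<close>] by (intro sum.cong) (auto simp: hk_0)
  then show ?case using assms(1,2) by simp
next
  case (Suc j)
  have "(\<Sum>a\<in>S. deg n0 G a * hk x (Suc j) a * hk y k a) = (\<Sum>a\<in>S. deg n0 G a * hk x j a * hk y (Suc k) a)"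
    unfolding hk_Suc by (rule avg_symmetric) (use assms Suc.prems in auto)
  then show ?case using Suc by simp
qed

lemma hk_commute:
  assumes "x \<in> G" "y \<in> G" shows "hk x k y = hk y k x"
proof -
  define S where "S = {z \<in> G. tdist x z \<le> k} \<union> {z \<in> G. tdist y z \<le> k}"
  have S: "finite S" "x \<in> S" "y \<in> S" using assms finite_tball by (auto simp: S_def)
  have 0: "hk x i a = 0" "hk y i a = 0" if "i \<le> k" "a \<notin> S" for i a
    using hk_support[OF assms(1), of i a] hk_support[OF assms(2), of i a] that by (fastforce simp: S_def)+
  \<comment> \<open>The inner product of \<open>hk x k\<close> with the point mass at
    \<open>y\<close> is evaluated twice: moving no steps gives one side, moving all \<open>k\<close>
    steps gives the other.\<close>
  have "hk x (k + 0) y = (\<Sum>a\<in>S. deg n0 G a * hk y 0 a * hk x k a)"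
    using hk_dot[where S = S and x = y and y = x and n = k and j = 0 and k = k, OF S(1,3) 0(2,1) assms(2)] by simp
  also have "\<dots> = (\<Sum>a\<in>S. deg n0 G a * hk x k a * hk y 0 a)" by (simp add: mult_ac)
  also have "\<dots> = hk y (k + 0) x"
    by (rule hk_dot[where n = k, OF S(1,2) 0 assms(1)]) auto
  finally show ?thesis by simp
qed

section \<open>Continuous time and finite truncations\<close>

lemma q_eq_pavg:
  assumes "x \<in> G" "y \<in> G" shows "q n0 G s x y = pavg s (\<lambda>k. hk x k y)"
proof -
  have "q n0 G s x y = (\<Sum>k. poisson_w s k * pstep n0 G k x y / deg n0 G y)"
    unfolding q_def trans_prob_def by (rule suminf_divide[symmetric]) (rule sums_summable[OF trans_prob_sums])
  then show ?thesis unfolding pavg_def hk_commute[OF assms] by (simp add: hk_def)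
qed

lemma q_nonneg: "x \<in> G \<Longrightarrow> y \<in> G \<Longrightarrow> s \<ge> 0 \<Longrightarrow> q n0 G s x y \<ge> 0"
  unfolding q_eq_pavg
  by (rule sums_le[OF _ sums_zero pavg_sums[OF abs_hk_le_1]]) (simp_all add: poisson_w_nonneg hk_nonneg)

text \<open>Truncating the Poisson series gives a finitely supported function, to which Green's
  formula for finite sets applies.\<close>

definition heat_trunc :: "nat \<Rightarrow> real \<Rightarrow> nat list \<Rightarrow> nat list \<Rightarrow> real" where
  "heat_trunc N s x a = (\<Sum>k\<le>N. poisson_w s k * hk x k a)"

lemma heat_trunc_limit:
  assumes "x \<in> G" "y \<in> G" shows "(\<lambda>N. heat_trunc N s x y) \<longlonglongrightarrow> q n0 G s x y"
  using pavg_sums[of "\<lambda>k. hk x k y" 1 s, OF abs_hk_le_1[OF assms(1)]]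
  by (simp add: heat_trunc_def sums_def_le q_eq_pavg[OF assms])

lemma hk_zero_outside:
  assumes "x \<in> G" "k \<le> n" "a \<notin> {z \<in> G. tdist x z \<le> n}" shows "hk x k a = 0"
  using hk_support[OF assms(1), of k a] assms(2,3) by fastforce

lemma hk_dot_self:
  assumes "x \<in> G" "j + k \<le> n"
  shows "(\<Sum>a | a \<in> G \<and> tdist x a \<le> n. deg n0 G a * hk x j a * hk x k a) = hk x (j + k) x"
  by (rule hk_dot[where n = n]) (use assms finite_tball in \<open>simp_all add: hk_zero_outside\<close>)

lemma heat_trunc_norm:
  assumes "x \<in> G" "2 * N \<le> n"
  shows "(\<Sum>a | a \<in> G \<and> tdist x a \<le> n. deg n0 G a * (heat_trunc N s x a)\<^sup>2)
       = (\<Sum>j\<le>N. \<Sum>k\<le>N. poisson_w s j * poisson_w s k * hk x (j + k) x)"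
proof -
  have "(\<Sum>a | a \<in> G \<and> tdist x a \<le> n. deg n0 G a * (heat_trunc N s x a)\<^sup>2)
     = (\<Sum>a | a \<in> G \<and> tdist x a \<le> n. (\<Sum>j\<le>N. poisson_w s j * (deg n0 G a * hk x j a)) *
          (\<Sum>k\<le>N. poisson_w s k * hk x k a))"
    unfolding heat_trunc_def power2_eq_square mult.assoc[symmetric] sum_distrib_left
    by (simp add: mult_ac)
  also have "\<dots> = (\<Sum>j\<le>N. \<Sum>k\<le>N. poisson_w s j * poisson_w s k * hk x (j + k) x)"
    unfolding sum_bilinear using assms by (intro sum.cong refl) (simp add: hk_dot_self)
  finally show ?thesis .
qed

text \<open>The Laplacian costs one more step than the norm, hence \<open>2 * N < n\<close> here
  against \<open>2 * N \<le> n\<close> in \<open>heat_trunc_norm\<close>.\<close>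

lemma heat_trunc_energy:
  assumes "x \<in> G" "2 * N < n"
  shows "(\<Sum>a | a \<in> G \<and> tdist x a \<le> n. heat_trunc N s x a * lap (heat_trunc N s x) a)
       = (\<Sum>j\<le>N. \<Sum>k\<le>N. poisson_w s j * poisson_w s k * (hk x (j + k) x - hk x (Suc (j + k)) x))"
proof -
  have lap: "lap (heat_trunc N s x) a
      = (\<Sum>k\<le>N. poisson_w s k * (deg n0 G a * (hk x k a - hk x (Suc k) a)))" for a
  proof -
    have "lap (heat_trunc N s x) a = (\<Sum>b\<in>nb a. \<Sum>k\<le>N. poisson_w s k * (hk x k a - hk x k b))"
      unfolding lap_def heat_trunc_def by (simp add: right_diff_distrib sum_subtractf)
    also have "\<dots> = (\<Sum>k\<le>N. poisson_w s k * lap (hk x k) a)"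
      by (subst sum.swap) (simp add: lap_def sum_distrib_left)
    finally show ?thesis by (simp add: lap_eq_avg hk_Suc)
  qed
  show ?thesis
    unfolding lap heat_trunc_def sum_bilinear
  proof (intro sum.cong refl)
    fix j k assume jk: "j \<in> {..N}" "k \<in> {..N}"
    have "(\<Sum>a | a \<in> G \<and> tdist x a \<le> n. hk x j a * (deg n0 G a * (hk x k a - hk x (Suc k) a)))
      = (\<Sum>a | a \<in> G \<and> tdist x a \<le> n. deg n0 G a * hk x j a * hk x k a)
      - (\<Sum>a | a \<in> G \<and> tdist x a \<le> n. deg n0 G a * hk x j a * hk x (Suc k) a)"
      by (simp add: sum_subtractf[symmetric] algebra_simps)
    also have "\<dots> = hk x (j + k) x - hk x (j + Suc k) x"
      using jk assms by (simp add: hk_dot_self)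
    finally show "poisson_w s j * poisson_w s k *
        (\<Sum>a | a \<in> G \<and> tdist x a \<le> n. hk x j a * (deg n0 G a * (hk x k a - hk x (Suc k) a)))
      = poisson_w s j * poisson_w s k * (hk x (j + k) x - hk x (Suc (j + k)) x)"
      by simp
  qed
qed

text \<open>Convexity of the diagonal in time. The second difference at j + k is the inner product
  of (I - P)P^j and (I - P)P^k applied to the point mass, so averaging over two Poisson times of
  mean t/2 gives a limit of squared norms. For a single odd k it is negative, since returns take an
  even number of steps.\<close>

lemma pavg_second_difference_nonneg:
  assumes "x \<in> G" "t \<ge> 0"
  shows "pavg t (\<lambda>k. hk x k x - 2 * hk x (Suc k) x + hk x (Suc (Suc k)) x) \<ge> 0"
proof -
  define e where "e k = hk x k x - 2 * hk x (Suc k) x + hk x (Suc (Suc k)) x" for k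
  define s where "s = t / 2"
  have s: "s \<ge> 0" "t = 2 * s" using assms(2) by (auto simp: s_def)
  have e: "\<bar>e k\<bar> \<le> 2" for k
    using hk_nonneg[of x k x] hk_nonneg[of x "Suc k" x] hk_nonneg[of x "Suc (Suc k)" x]
      hk_le_1[OF assms(1), of k x] hk_le_1[OF assms(1), of "Suc k" x] hk_le_1[OF assms(1), of "Suc (Suc k)" x]
    unfolding e_def by linarith
  have "(\<Sum>j\<le>N. \<Sum>k\<le>N. poisson_w s j * poisson_w s k * e (j + k)) \<ge> 0" for N
  proof -
    define S where "S = {a. a \<in> G \<and> tdist x a \<le> 2 * N + 2}"
    define u where "u k a = hk x k a - hk x (Suc k) a" for k a
    have u: "(\<Sum>a\<in>S. deg n0 G a * u j a * u k a) = e (j + k)" if "j \<le> N" "k \<le> N" for j k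
    proof -
      have "(\<Sum>a\<in>S. deg n0 G a * u j a * u k a)
        = (\<Sum>a\<in>S. deg n0 G a * hk x j a * hk x k a) - (\<Sum>a\<in>S. deg n0 G a * hk x (Suc j) a * hk x k a)
        - (\<Sum>a\<in>S. deg n0 G a * hk x j a * hk x (Suc k) a)
        + (\<Sum>a\<in>S. deg n0 G a * hk x (Suc j) a * hk x (Suc k) a)"
        by (simp add: sum_subtractf[symmetric] sum.distrib[symmetric] algebra_simps u_def)
      also have "\<dots> = e (j + k)" using that assms(1) by (simp add: hk_dot_self e_def S_def)
      finally show ?thesis .
    qed
    have "0 \<le> (\<Sum>a\<in>S. deg n0 G a * (\<Sum>k\<le>N. poisson_w s k * u k a)\<^sup>2)"
      by (intro sum_nonneg mult_nonneg_nonneg) (simp_all add: deg_nonneg)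
    also have "\<dots> = (\<Sum>a\<in>S. (\<Sum>j\<le>N. poisson_w s j * (deg n0 G a * u j a)) * (\<Sum>k\<le>N. poisson_w s k * u k a))"
      unfolding power2_eq_square mult.assoc[symmetric] sum_distrib_left by (simp add: mult_ac)
    also have "\<dots> = (\<Sum>j\<le>N. \<Sum>k\<le>N. poisson_w s j * poisson_w s k * e (j + k))"
      unfolding sum_bilinear by (intro sum.cong refl) (simp add: u)
    finally show ?thesis .
  qed
  then have "0 \<le> pavg (2 * s) e"
    using LIMSEQ_le_const[OF pavg_double_limit[of s e 2, OF s(1) e]] by blast
  then show ?thesis by (simp add: s(2) e_def[abs_def])
qed

text \<open>With \<open>\<phi>(t) = q\<^sub>t(x, x)\<close>, the left side below is \<open>-\<phi>'(2s)\<close>, the Dirichlet energy of \<open>q\<^sub>s(x, \<cdot>)\<close>;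
  the bound is convexity and positivity of \<open>\<phi>\<close>.\<close>

lemma pavg_first_difference_le:
  assumes "x \<in> G" "s > 0"
  shows "pavg (2 * s) (\<lambda>k. hk x k x - hk x (Suc k) x) \<le> pavg s (\<lambda>k. hk x k x) / s"
proof -
  define a where "a k = hk x k x" for k
  define c where "c k = a k - a (Suc k)" for k
  define \<phi> where "\<phi> t = pavg t a" for t
  define \<psi> where "\<psi> t = pavg t c" for t
  have a: "\<bar>a k\<bar> \<le> 1" for k using abs_hk_le_1[OF assms(1)] by (simp add: a_def)
  have c: "\<bar>c k\<bar> \<le> 1" for k
    using hk_nonneg[of x k x] hk_nonneg[of x "Suc k" x] hk_le_1[OF assms(1), of k x] hk_le_1[OF assms(1), of "Suc k" x]
    unfolding c_def a_def by linarith
  have \<phi>': "(\<phi> has_real_derivative - \<psi> t) (at t)" for t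
    using pavg_has_derivative[of a 1 t, OF a] pavg_minus[of c 1 t, OF c]
    by (simp add: \<phi>_def[abs_def] \<psi>_def c_def)
  have dec: "\<psi> t \<ge> \<psi> (2 * s)" if "s \<le> t" "t \<le> 2 * s" for t
  proof (rule DERIV_nonpos_imp_nonincreasing[OF that(2)])
    fix u assume "t \<le> u" "u \<le> 2 * s"
    then have "u \<ge> 0" using that assms(2) by simp
    define e where "e k = c k - c (Suc k)" for k
    have e: "\<bar>e k\<bar> \<le> 2" for k using c[of k] c[of "Suc k"] unfolding e_def by linarith
    have "pavg u e \<ge> 0"
      using pavg_second_difference_nonneg[OF assms(1) \<open>u \<ge> 0\<close>] by (simp add: e_def[abs_def] c_def a_def algebra_simps)
    moreover have "(\<psi> has_real_derivative - pavg u e) (at u)"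
      using pavg_has_derivative[of c 1 u, OF c] pavg_minus[of e 2 u, OF e] by (simp add: \<psi>_def[abs_def] e_def)
    ultimately show "\<exists>y. (\<psi> has_real_derivative y) (at u) \<and> y \<le> 0" by fastforce
  qed
  \<comment> \<open>The mean value theorem makes \<open>s * \<psi> z\<close> equal to
    \<open>\<phi> s - \<phi> (2 * s)\<close>, hence at most \<open>\<phi> s\<close>, and
    \<open>\<psi> (2 * s)\<close> is at most \<open>\<psi> z\<close>.\<close>
  obtain z where z: "s < z" "z < 2 * s" "\<phi> (2 * s) - \<phi> s = (2 * s - s) * - \<psi> z"
    using MVT2[of s "2 * s" \<phi> "\<lambda>t. - \<psi> t"] \<phi>' assms(2) by auto
  have "0 \<le> \<phi> (2 * s)"
    unfolding \<phi>_def using sums_le[OF _ sums_zero pavg_sums[of a 1, OF a]] assms(2)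
    by (simp add: a_def poisson_w_nonneg hk_nonneg)
  then have "s * \<psi> z \<le> \<phi> s" using z(3) by (simp add: algebra_simps)
  moreover have "s * \<psi> (2 * s) \<le> s * \<psi> z" using dec[of z] z assms(2) by simp
  ultimately have "s * \<psi> (2 * s) \<le> \<phi> s" by (rule order_trans[rotated])
  then have "\<psi> (2 * s) \<le> \<phi> s / s" using assms(2) by (simp add: pos_le_divide_eq mult.commute)
  then show ?thesis by (simp add: \<phi>_def \<psi>_def a_def[abs_def] c_def[abs_def])
qed

text \<open>The resistance bound is applied to each truncation; by \<open>pavg_double_limit\<close>
  the energies converge to the average at time 2s that \<open>pavg_first_difference_le\<close>
  controls.\<close>

lemma heat_kernel_gradient:
  assumes "x \<in> G" "y \<in> G" "s > 0"
  shows "(q n0 G s x y - q n0 G s x x)\<^sup>2 \<le> tdist x y * q n0 G s x x / s"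
proof -
  define c where "c k = hk x k x - hk x (Suc k) x" for k
  have c: "\<bar>c k\<bar> \<le> 1" for k
    using hk_nonneg[of x k x] hk_nonneg[of x "Suc k" x] hk_le_1[OF assms(1), of k x] hk_le_1[OF assms(1), of "Suc k" x]
    unfolding c_def by linarith
  have fin: "(heat_trunc N s x y - heat_trunc N s x x)\<^sup>2
      \<le> tdist x y * (\<Sum>j\<le>N. \<Sum>k\<le>N. poisson_w s j * poisson_w s k * c (j + k))" for N
  proof -
    define S where "S = {a \<in> G. tdist x a \<le> 2 * N + 1}"
    have "finite S" using finite_tball assms(1) by (simp add: S_def)
    moreover have "heat_trunc N s x a = 0" if "a \<notin> S" for a
      unfolding heat_trunc_def using that hk_zero_outside[OF assms(1), of _ "2 * N + 1" a]
      by (intro sum.neutral) (auto simp: S_def)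
    ultimately have "(heat_trunc N s x y - heat_trunc N s x x)\<^sup>2
        \<le> tdist x y * (\<Sum>a\<in>S. heat_trunc N s x a * lap (heat_trunc N s x) a)"
      using assms by (intro diff_sq_le_energy) auto
    then show ?thesis using heat_trunc_energy[OF assms(1), of N "2 * N + 1" s] by (simp add: S_def c_def)
  qed
  have "(q n0 G s x y - q n0 G s x x)\<^sup>2 \<le> tdist x y * pavg (2 * s) c"
  proof (rule LIMSEQ_le)
    show "(\<lambda>N. (heat_trunc N s x y - heat_trunc N s x x)\<^sup>2) \<longlonglongrightarrow> (q n0 G s x y - q n0 G s x x)\<^sup>2"
      by (intro tendsto_intros heat_trunc_limit assms)
    show "(\<lambda>N. tdist x y * (\<Sum>j\<le>N. \<Sum>k\<le>N. poisson_w s j * poisson_w s k * c (j + k)))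
        \<longlonglongrightarrow> tdist x y * pavg (2 * s) c"
      using assms(3) by (intro tendsto_intros pavg_double_limit[of s c 1, OF _ c]) auto
    show "\<exists>M. \<forall>N\<ge>M. (heat_trunc N s x y - heat_trunc N s x x)\<^sup>2
      \<le> tdist x y * (\<Sum>j\<le>N. \<Sum>k\<le>N. poisson_w s j * poisson_w s k * c (j + k))"
      using fin by blast
  qed
  also have "\<dots> \<le> tdist x y * (q n0 G s x x / s)"
    using pavg_first_difference_le[OF assms(1,3)]
    by (intro mult_left_mono) (auto simp: q_eq_pavg assms c_def[abs_def])
  finally show ?thesis by simp
qed

text \<open>Cauchy-Schwarz for the degree measure on \<open>B\<close>: the squared norm of the
  kernel at time s is its diagonal value at time 2s.\<close>

lemma heat_kernel_cauchy_schwarz: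
  assumes "x \<in> G" "finite B" "B \<subseteq> G" "s \<ge> 0"
  shows "(\<Sum>y\<in>B. trans_prob n0 G s x y)\<^sup>2 \<le> mu n0 G B * q n0 G (2 * s) x x"
proof -
  have fin: "(\<Sum>y\<in>B. deg n0 G y * heat_trunc N s x y)\<^sup>2
     \<le> mu n0 G B * (\<Sum>j\<le>N. \<Sum>k\<le>N. poisson_w s j * poisson_w s k * hk x (j + k) x)" for N
  proof -
    define S where "S = {a \<in> G. tdist x a \<le> 2 * N}"
    have S: "finite S" using finite_tball assms(1) by (simp add: S_def)
    have out: "heat_trunc N s x a = 0" if "a \<notin> S" for a
      unfolding heat_trunc_def using that hk_zero_outside[OF assms(1), of _ "2 * N" a]
      by (intro sum.neutral) (auto simp: S_def)
    have "(\<Sum>y\<in>B. deg n0 G y * heat_trunc N s x y)\<^sup>2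
        = (\<Sum>y\<in>B. sqrt (deg n0 G y) * (sqrt (deg n0 G y) * heat_trunc N s x y))\<^sup>2"
      by (simp add: deg_nonneg flip: mult.assoc)
    also have "\<dots> \<le> (\<Sum>y\<in>B. (sqrt (deg n0 G y))\<^sup>2) * (\<Sum>y\<in>B. (sqrt (deg n0 G y) * heat_trunc N s x y)\<^sup>2)"
      by (rule Cauchy_Schwarz_ineq_sum)
    also have "\<dots> = mu n0 G B * (\<Sum>y\<in>B. deg n0 G y * (heat_trunc N s x y)\<^sup>2)"
      by (simp add: mu_def power_mult_distrib deg_nonneg)
    also have "(\<Sum>y\<in>B. deg n0 G y * (heat_trunc N s x y)\<^sup>2) = (\<Sum>y\<in>B \<inter> S. deg n0 G y * (heat_trunc N s x y)\<^sup>2)"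
      using assms(2) out by (intro sum.mono_neutral_right) auto
    also have "\<dots> \<le> (\<Sum>y\<in>S. deg n0 G y * (heat_trunc N s x y)\<^sup>2)"
      using S by (intro sum_mono2) (auto simp: deg_nonneg)
    also have "\<dots> = (\<Sum>j\<le>N. \<Sum>k\<le>N. poisson_w s j * poisson_w s k * hk x (j + k) x)"
      unfolding S_def by (rule heat_trunc_norm) (use assms in auto)
    finally show ?thesis by (simp add: mult_left_mono mu_def sum_nonneg deg_nonneg)
  qed
  have deg_q: "trans_prob n0 G s x y = deg n0 G y * q n0 G s x y" if "y \<in> B" for y
    using deg_ge_1[of y] that assms(3) by (auto simp: q_def)
  have "(\<Sum>y\<in>B. deg n0 G y * q n0 G s x y)\<^sup>2 \<le> mu n0 G B * pavg (2 * s) (\<lambda>k. hk x k x)"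
  proof (rule LIMSEQ_le)
    show "(\<lambda>N. (\<Sum>y\<in>B. deg n0 G y * heat_trunc N s x y)\<^sup>2) \<longlonglongrightarrow> (\<Sum>y\<in>B. deg n0 G y * q n0 G s x y)\<^sup>2"
      using assms by (intro tendsto_intros heat_trunc_limit) auto
    show "(\<lambda>N. mu n0 G B * (\<Sum>j\<le>N. \<Sum>k\<le>N. poisson_w s j * poisson_w s k * hk x (j + k) x))
        \<longlonglongrightarrow> mu n0 G B * pavg (2 * s) (\<lambda>k. hk x k x)"
      by (intro tendsto_intros pavg_double_limit[where M = 1] assms(4) abs_hk_le_1[OF assms(1)])
  qed (use fin in blast)
  then show ?thesis using assms(1) by (simp add: q_eq_pavg deg_q)
qed

lemma heat_kernel_diagonal_upper:
  assumes "x \<in> G" "s > 0" "\<rho> \<ge> 0"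
  shows "q n0 G s x x \<le> max (2 / vol n0 G x \<rho>) (4 * \<rho> / s)"
proof -
  define B where "B = ball n0 G x \<rho>"
  define Q where "Q = q n0 G s x x"
  have B: "finite B" "B \<subseteq> G" "x \<in> B" "\<And>y. y \<in> B \<Longrightarrow> tdist x y \<le> \<rho>"
    using assms finite_ball[OF assms(1), of \<rho>] by (auto simp: B_def ball_eq)
  have "mu n0 G B \<ge> deg n0 G x"
    unfolding mu_def using B by (intro member_le_sum) (auto simp: deg_nonneg)
  then have V: "mu n0 G B > 0" using deg_ge_1[OF assms(1)] by simp
  have Q0: "Q \<ge> 0" using q_nonneg assms by (simp add: Q_def)
  define g where "g = sqrt (\<rho> * Q / s)"
  have diff: "Q - q n0 G s x y \<le> g" if "y \<in> B" for y
  proof -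
    have "(q n0 G s x y - Q)\<^sup>2 \<le> tdist x y * Q / s"
      unfolding Q_def using heat_kernel_gradient[OF assms(1) _ assms(2)] B that by blast
    also have "\<dots> \<le> \<rho> * Q / s"
      using B(4)[OF that] Q0 assms(2) by (intro divide_right_mono mult_right_mono) auto
    finally have "\<bar>q n0 G s x y - Q\<bar> \<le> g" unfolding g_def by (rule real_le_rsqrt[of "\<bar>_\<bar>", simplified power2_abs])
    then show ?thesis by simp
  qed
  \<comment> \<open>The total mass is at most 1, so the mean of the kernel over \<open>B\<close> is
    at most 1/mu(B), and \<open>Q\<close> exceeds this mean by at most \<open>g\<close>.\<close>
  have "Q * mu n0 G B - 1 \<le> Q * mu n0 G B - (\<Sum>y\<in>B. trans_prob n0 G s x y)"
    using sum_trans_prob_le_1[OF B(1), of s n0 G x] assms(2) by simp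
  also have "\<dots> = (\<Sum>y\<in>B. deg n0 G y * (Q - q n0 G s x y))"
  proof -
    have "trans_prob n0 G s x y = deg n0 G y * q n0 G s x y" if "y \<in> B" for y
      using deg_ge_1[of y] that B(2) by (auto simp: q_def)
    then show ?thesis by (simp add: mu_def sum_distrib_left right_diff_distrib sum_subtractf mult.commute)
  qed
  also have "\<dots> \<le> (\<Sum>y\<in>B. deg n0 G y * g)"
    by (intro sum_mono mult_left_mono diff) (auto simp: deg_nonneg)
  also have "\<dots> = mu n0 G B * g" by (simp add: mu_def sum_distrib_right)
  finally have main: "Q \<le> 1 / mu n0 G B + g" using V by (simp add: field_simps)
  show ?thesis
  proof (cases "Q \<le> 2 / mu n0 G B")
    case True
    then show ?thesis by (simp add: Q_def vol_def B_def)
  next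
    case False
    \<comment> \<open>Here 1/mu(B) is below Q/2, so \<open>g\<close> carries at least Q/2; after
      squaring, one factor \<open>Q\<close> cancels.\<close>
    then have "Q / 2 \<le> g" using main by simp
    then have "(Q / 2)\<^sup>2 \<le> g\<^sup>2" using Q0 by (intro power_mono) auto
    also have "g\<^sup>2 = \<rho> * Q / s" unfolding g_def using Q0 assms by simp
    finally have "Q * Q \<le> Q * (4 * \<rho> / s)" by (simp add: power2_eq_square field_simps)
    moreover have "Q > 0" using False V Q0 by (smt (verit) divide_pos_pos)
    ultimately have "Q \<le> 4 * \<rho> / s" by (rule mult_left_le_imp_le)
    then show ?thesis by (simp add: Q_def)
  qed
qed

end

subsection \<open>Exit times\<close>

lemma pstay_nonneg: "pstay n0 G B k x \<ge> 0"
  by (induction k arbitrary: x) (auto intro!: sum_nonneg simp: deg_def)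

lemma pstay_outside: "x \<notin> B \<Longrightarrow> pstay n0 G B k x = 0"
  by (cases k) auto

lemma pstay_le_sum_pstep:
  assumes "finite B" shows "pstay n0 G B k x \<le> (\<Sum>y\<in>B. pstep n0 G k x y)"
proof (induction k arbitrary: x)
  case 0
  then show ?case using assms by simp
next
  case (Suc k)
  have "pstay n0 G B (Suc k) x \<le> (\<Sum>z | adjG n0 G x z. pstay n0 G B k z / deg n0 G x)"
    by (auto intro!: sum_nonneg simp: pstay_nonneg deg_def)
  also have "\<dots> \<le> (\<Sum>z | adjG n0 G x z. (\<Sum>y\<in>B. pstep n0 G k z y) / deg n0 G x)"
    by (intro sum_mono divide_right_mono Suc) (simp add: deg_def)
  also have "\<dots> = (\<Sum>y\<in>B. pstep n0 G (Suc k) x y)"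
    by (simp add: sum.swap[of _ B] sum_divide_distrib)
  finally show ?case .
qed

lemma pstay_le_1: "pstay n0 G B k x \<le> 1"
proof (induction k arbitrary: x)
  case (Suc k)
  have "(\<Sum>z | adjG n0 G x z. pstay n0 G B k z / deg n0 G x) \<le> (\<Sum>z | adjG n0 G x z. 1 / deg n0 G x)"
    by (intro sum_mono divide_right_mono Suc) (simp add: deg_def)
  also have "\<dots> \<le> 1" by (simp add: deg_def)
  finally show ?case by simp
qed auto

lemma surv_sums: "(\<lambda>k. poisson_w t k * pstay n0 G B k x) sums surv n0 G B x t"
  using pavg_sums[of "\<lambda>k. pstay n0 G B k x" 1 t]
  by (simp add: surv_def pavg_def pstay_nonneg pstay_le_1)

lemma surv_le_sum_trans_prob:
  assumes "finite B" "t \<ge> 0" shows "surv n0 G B x t \<le> (\<Sum>y\<in>B. trans_prob n0 G t x y)"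
proof (rule sums_le[OF _ surv_sums])
  show "(\<lambda>k. \<Sum>y\<in>B. poisson_w t k * pstep n0 G k x y) sums (\<Sum>y\<in>B. trans_prob n0 G t x y)"
    by (intro sums_sum trans_prob_sums)
  show "poisson_w t k * pstay n0 G B k x \<le> (\<Sum>y\<in>B. poisson_w t k * pstep n0 G k x y)" for k
    unfolding sum_distrib_left[symmetric]
    by (intro mult_left_mono pstay_le_sum_pstep poisson_w_nonneg assms)
qed

text \<open>The time spent between jumps k and k + 1 has mean 1, as t^k exp(-t)/k! integrates to 1.
  Hence the walk and its jump chain have the same mean exit time.\<close>

lemma exit_time_mean_eq_suminf:
  "exit_time_mean n0 G B x = (\<Sum>k. ennreal (pstay n0 G B k x))"
proof -
  define v where "v k = pstay n0 G B k x" for k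
  have v: "v k \<ge> 0" for k by (simp add: v_def pstay_nonneg)
  have "ennreal (surv n0 G B x t) * indicator {0..} t
      = (\<Sum>k. ennreal (v k / fact k) * (ennreal (t ^ k * exp (- t)) * indicator {0..} t))" for t
  proof (cases "t \<ge> 0")
    case True
    have "ennreal (surv n0 G B x t) = (\<Sum>k. ennreal (poisson_w t k * v k))"
      unfolding surv_def v_def
      by (intro suminf_ennreal2[symmetric] sums_summable[OF surv_sums] mult_nonneg_nonneg
            poisson_w_nonneg pstay_nonneg True)
    also have "\<dots> = (\<Sum>k. ennreal (v k / fact k) * ennreal (t ^ k * exp (- t)))"
      using True v by (intro suminf_cong) (simp add: poisson_w_def mult_ac flip: ennreal_mult)
    finally show ?thesis using True by simp
  qed simp
  then have "exit_time_mean n0 G B x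
      = (\<integral>\<^sup>+ t. (\<Sum>k. ennreal (v k / fact k) * (ennreal (t ^ k * exp (- t)) * indicator {0..} t)) \<partial>lborel)"
    by (simp add: exit_time_mean_def)
  also have "\<dots> = (\<Sum>k. \<integral>\<^sup>+ t. ennreal (v k / fact k) * (ennreal (t ^ k * exp (- t)) * indicator {0..} t) \<partial>lborel)"
    by (rule nn_integral_suminf) measurable
  also have "\<dots> = (\<Sum>k. ennreal (v k / fact k) * ennreal (fact k))"
    by (subst nn_integral_cmult) (simp_all add: nn_intergal_power_times_exp_Ici)
  also have "\<dots> = (\<Sum>k. ennreal (v k))"
    using v by (simp flip: ennreal_mult)
  finally show ?thesis by (simp add: v_def)
qed

context infinite_subtree
begin

text \<open>The function T of the overview, as a real series. Its convergence comes from the bound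
  on partial sums in \<open>exit_partial_sum_le\<close>.\<close>

definition exit_sum :: "nat list set \<Rightarrow> nat list \<Rightarrow> real" where
  "exit_sum B x = (\<Sum>k. pstay n0 G B k x)"

text \<open>Testing the expected exit time \<open>T\<close> against its truncation at height \<open>T(x)\<close> replaces a maximum
  principle for the Green function.\<close>

lemma exit_partial_sum_le:
  assumes B: "finite B" and x: "x \<in> G" and w: "w \<in> G - B"
  shows "(\<Sum>k<N. pstay n0 G B k x) \<le> tdist x w * mu n0 G B"
proof -
  define T where "T N a = (\<Sum>k<N. pstay n0 G B k a)" for N a
  have T0: "T N a \<ge> 0" for N a by (simp add: T_def sum_nonneg pstay_nonneg)
  have Tout: "T N a = 0" if "a \<notin> B" for N a using that by (simp add: T_def pstay_outside)
  \<comment> \<open>Partial sums increase and satisfy T(N + 1) = 1 + P T(N) on \<open>B\<close>, so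
    they obey the Poisson equation as an inequality.\<close>
  have lapT: "lap (T N) a \<le> deg n0 G a" if "a \<in> B" for a
  proof -
    have "T N a \<le> T (Suc N) a" by (simp add: T_def pstay_nonneg)
    also have "\<dots> = 1 + avg (T N) a"
      unfolding T_def sum.lessThan_Suc_shift avg_def using that
      by (simp add: sum_divide_distrib sum.swap[of _ _ "{..<N}"])
    finally have "T N a - avg (T N) a \<le> 1" by simp
    then show ?thesis unfolding lap_eq_avg using mult_left_mono[OF _ deg_nonneg] by fastforce
  qed
  define f where "f a = min (T N a) (T N x)" for a
  have fout: "f a = 0" if "a \<notin> B" for a using Tout[OF that] T0 by (simp add: f_def)
  have "(T N x)\<^sup>2 = (f w - f x)\<^sup>2" using fout[of w] w by (simp add: f_def)
  also have "\<dots> \<le> tdist x w * (\<Sum>a\<in>B. f a * lap f a)"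
    using w by (intro diff_sq_le_energy B fout x) auto
  also have "(\<Sum>a\<in>B. f a * lap f a) \<le> (\<Sum>a\<in>B. f a * lap (T N) a)"
  proof -
    \<comment> \<open>Cutting off at a level shrinks each edge difference and keeps its
      sign.\<close>
    have contract: "(f a - f b) * (f a - f b) \<le> (f a - f b) * (T N a - T N b)" for a b
    proof (cases "T N a \<le> T N b")
      case True
      then have "f a - f b \<le> 0" "T N a - T N b \<le> f a - f b" by (auto simp: f_def)
      then show ?thesis by (intro mult_left_mono_neg)
    next
      case False
      then have "0 \<le> f a - f b" "f a - f b \<le> T N a - T N b" by (auto simp: f_def)
      then show ?thesis by (intro mult_left_mono)
    qed
    have "(\<Sum>(a, b)\<in>touching B. (f a - f b) * (f a - f b))
        \<le> (\<Sum>(a, b)\<in>touching B. (f a - f b) * (T N a - T N b))"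
      by (rule sum_mono) (auto simp: contract)
    then show ?thesis
      using green_formula[of B f f, OF B fout] green_formula[of B f "T N", OF B fout] by simp
  qed
  also have "\<dots> \<le> (\<Sum>a\<in>B. T N x * deg n0 G a)"
  proof (rule sum_mono)
    fix a assume "a \<in> B"
    have "f a * lap (T N) a \<le> f a * deg n0 G a"
      using lapT[OF \<open>a \<in> B\<close>] T0 by (intro mult_left_mono) (auto simp: f_def)
    also have "\<dots> \<le> T N x * deg n0 G a"
      by (intro mult_right_mono deg_nonneg) (simp add: f_def)
    finally show "f a * lap (T N) a \<le> T N x * deg n0 G a" .
  qed
  also have "\<dots> = T N x * mu n0 G B" by (simp add: mu_def sum_distrib_left)
  finally have "(T N x)\<^sup>2 \<le> tdist x w * (T N x * mu n0 G B)" by (simp add: mult_left_mono)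
  then have "T N x * T N x \<le> T N x * (tdist x w * mu n0 G B)"
    by (simp add: power2_eq_square mult_ac)
  then have "T N x \<le> tdist x w * mu n0 G B \<or> T N x = 0"
    using T0[of N x] by (auto simp: mult_le_cancel_left)
  moreover have "0 \<le> tdist x w * mu n0 G B" by (simp add: mu_def sum_nonneg deg_nonneg)
  ultimately show ?thesis by (auto simp: T_def)
qed

lemma pstay_summable:
  assumes "finite B" "B \<subseteq> G" shows "summable (\<lambda>k. pstay n0 G B k x)"
proof (cases "x \<in> B")
  case True
  have "G - B \<noteq> {}" using infinite finite_subset[OF _ assms(1), of G] by auto
  then obtain w where "w \<in> G - B" by blast
  then show ?thesis
    using True assms(2)
    by (intro summableI_nonneg_bounded[OF pstay_nonneg exit_partial_sum_le[OF assms(1)]]) auto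
qed (simp add: pstay_outside)

lemma exit_sum_le:
  assumes "finite B" "x \<in> G" "w \<in> G - B" 
  shows "exit_sum B x \<le> tdist x w * mu n0 G B"
proof -
  have "summable (\<lambda>k. pstay n0 G B k x)"
    using exit_partial_sum_le[OF assms] by (intro summableI_nonneg_bounded[OF pstay_nonneg])
  then show ?thesis unfolding exit_sum_def using exit_partial_sum_le[OF assms] by (rule suminf_le_const)
qed

lemma exit_sum_nonneg: "finite B \<Longrightarrow> B \<subseteq> G \<Longrightarrow> exit_sum B x \<ge> 0"
  unfolding exit_sum_def by (intro suminf_nonneg pstay_summable pstay_nonneg)

lemma exit_sum_outside: "x \<notin> B \<Longrightarrow> exit_sum B x = 0"
  by (simp add: exit_sum_def pstay_outside)

lemma exit_time_mean_eq:
  assumes "finite B" "B \<subseteq> G" shows "exit_time_mean n0 G B x = ennreal (exit_sum B x)"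
  unfolding exit_time_mean_eq_suminf exit_sum_def
  by (intro suminf_ennreal2 pstay_nonneg pstay_summable assms)

lemma exit_sum_poisson:
  assumes "finite B" "B \<subseteq> G" "a \<in> B"
  shows "exit_sum B a = 1 + avg (exit_sum B) a"
proof -
  have "(\<lambda>k. \<Sum>z\<in>nb a. pstay n0 G B k z / deg n0 G a) sums (\<Sum>z\<in>nb a. exit_sum B z / deg n0 G a)"
    unfolding exit_sum_def using assms by (intro sums_sum sums_divide summable_sums pstay_summable) auto
  then have "(\<lambda>k. pstay n0 G B (Suc k) a) sums avg (exit_sum B) a"
    using assms(3) by (simp add: avg_def sum_divide_distrib)
  from sums_Suc[OF this] assms(3) show ?thesis by (simp add: exit_sum_def sums_iff)
qed

text \<open>Moving the Laplacian from T to \<open>f\<close> leaves the sum of T times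
  \<open>lap f\<close>; as T is nonnegative, only the source at \<open>x\<close> can contribute
  positively. Any such \<open>f\<close> thus bounds T(x) from below.\<close>

lemma exit_sum_test_function:
  assumes B: "finite B" "B \<subseteq> G" and x: "x \<in> B"
    and f: "\<And>a. a \<notin> B \<Longrightarrow> f a = 0"
    and sub: "\<And>a. a \<in> B \<Longrightarrow> a \<noteq> x \<Longrightarrow> lap f a \<le> 0" and C: "lap f x \<le> C"
  shows "(\<Sum>a\<in>B. deg n0 G a * f a) \<le> C * exit_sum B x"
proof -
  have "(\<Sum>a\<in>B. deg n0 G a * f a) = (\<Sum>a\<in>B. f a * lap (exit_sum B) a)"
  proof (rule sum.cong)
    fix a assume "a \<in> B"
    then have "exit_sum B a - avg (exit_sum B) a = 1" using exit_sum_poisson[OF B] by simp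
    then show "deg n0 G a * f a = f a * lap (exit_sum B) a" by (simp add: lap_eq_avg)
  qed simp
  also have "\<dots> = (\<Sum>a\<in>B. exit_sum B a * lap f a)"
    by (rule lap_symmetric[OF B(1) f exit_sum_outside])
  also have "\<dots> \<le> (\<Sum>a\<in>B. if a = x then C * exit_sum B x else 0)"
  proof (rule sum_mono)
    fix a assume "a \<in> B"
    then show "exit_sum B a * lap f a \<le> (if a = x then C * exit_sum B x else 0)"
      using mult_left_mono[OF C exit_sum_nonneg[OF B, of x]] sub[of a] exit_sum_nonneg[OF B, of a]
      by (auto simp: mult.commute[of C] intro: mult_nonneg_nonpos)
  qed
  finally show ?thesis using B(1) x by simp
qed

text \<open>A Markov property at step \<open>n\<close> gives \<open>E\<^sup>x \<tau> \<le> n + T * P\<^sup>x(\<tau> > n)\<close>; being affine in \<open>n\<close>, the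
  resulting lower bound on \<open>P\<^sup>x(\<tau> > n)\<close> survives averaging over a Poisson time.\<close>

lemma surv_ge:
  assumes B: "finite B" "B \<subseteq> G" and T: "T > 0" "\<And>y. y \<in> B \<Longrightarrow> exit_sum B y \<le> T" and t: "t \<ge> 0"
  shows "(exit_sum B x - t) / T \<le> surv n0 G B x t"
proof -
  have tail: "(\<Sum>k<N. pstay n0 G B (n + k) y) \<le> T * pstay n0 G B n y" for N n y
  proof (induction n arbitrary: y)
    case 0
    show ?case
    proof (cases "y \<in> B")
      case True
      have "(\<Sum>k<N. pstay n0 G B k y) \<le> exit_sum B y"
        unfolding exit_sum_def by (intro sum_le_suminf pstay_summable B) (auto simp: pstay_nonneg)
      then show ?thesis using T(2)[OF True] True by simp
    qed (simp add: pstay_outside)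
  next
    case (Suc n)
    show ?case
    proof (cases "y \<in> B")
      case True
      have "(\<Sum>k<N. pstay n0 G B (Suc n + k) y) = (\<Sum>z\<in>nb y. (\<Sum>k<N. pstay n0 G B (n + k) z) / deg n0 G y)"
        using True by (simp add: sum.swap[of _ _ "{..<N}"] sum_divide_distrib)
      also have "\<dots> \<le> (\<Sum>z\<in>nb y. T * pstay n0 G B n z / deg n0 G y)"
        by (intro sum_mono divide_right_mono Suc deg_nonneg)
      also have "\<dots> = T * pstay n0 G B (Suc n) y"
        using True by (simp add: sum_distrib_left)
      finally show ?thesis .
    qed (simp add: pstay_outside)
  qed
  have markov: "(exit_sum B x - real n) / T \<le> pstay n0 G B n x" for n
  proof -
    have sm: "summable (\<lambda>k. pstay n0 G B k x)" by (rule pstay_summable[OF B])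
    have "exit_sum B x = (\<Sum>k. pstay n0 G B (n + k) x) + (\<Sum>k<n. pstay n0 G B k x)"
      unfolding exit_sum_def using suminf_split_initial_segment[OF sm, of n] by (simp add: add.commute)
    also have "(\<Sum>k. pstay n0 G B (n + k) x) \<le> T * pstay n0 G B n x"
      using summable_ignore_initial_segment[OF sm, of n] tail[where n = n and y = x]
      by (intro suminf_le_const) (simp_all add: add.commute[of n])
    also have "(\<Sum>k<n. pstay n0 G B k x) \<le> (\<Sum>k<n. 1)"
      by (intro sum_mono pstay_le_1)
    finally show ?thesis using T(1) by (simp add: field_simps)
  qed
  have "(\<lambda>n. (poisson_w t n * exit_sum B x - poisson_w t n * real n) / T) sums ((1 * exit_sum B x - t) / T)"
    by (intro sums_divide sums_diff sums_mult2 poisson_w_sums poisson_w_mean_sums)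
  then have "(\<lambda>n. poisson_w t n * ((exit_sum B x - real n) / T)) sums ((exit_sum B x - t) / T)"
    by (simp add: right_diff_distrib)
  then show ?thesis
    by (rule sums_le[OF mult_left_mono[OF markov poisson_w_nonneg[OF t]] _ surv_sums])
qed

subsection \<open>Cutsets and good balls\<close>

text \<open>The hypothesis says that \<open>A\<close> misses the geodesic from \<open>x\<close> to
  \<open>y\<close>. In contrapositive form, a separating set contains a point of the geodesic, which
  turns cutsets into identities between distances.\<close>

lemma geodesic_avoiding:
  assumes "x \<in> G" "y \<in> G" and "\<And>z. z \<in> A \<Longrightarrow> z \<in> G \<Longrightarrow> tdist x z + tdist z y \<noteq> tdist x y"
  shows "(adjG n0 (G - A))\<^sup>*\<^sup>* x y"
  using assms(2,3)
proof (induction "tdist x y" arbitrary: y)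
  case 0
  then show ?case by simp
next
  case (Suc n)
  then have "x \<noteq> y" by auto
  then obtain z where z: "adj z y" "tdist x y = Suc (tdist x z)"
    using closer_neighbour assms(1) Suc.prems(1) by blast
  have zG: "z \<in> G" using z(1) by (rule adj_in)
  have zy: "tdist z y = 1" using adjG_tdist[OF z(1), of z] by simp
  have "tdist x u + tdist u z \<noteq> tdist x z" if "u \<in> A" "u \<in> G" for u
    using Suc.prems(2)[OF that] tdist_triangle[OF that(2) zG Suc.prems(1)]
      tdist_triangle[OF assms(1) that(2) Suc.prems(1)] z(2) zy by linarith
  then have "(adjG n0 (G - A))\<^sup>*\<^sup>* x z"
    using Suc.hyps z(2) zG by simp
  moreover have "y \<notin> A" using Suc.prems(2)[of y] Suc.prems(1) by auto
  moreover have "z \<notin> A" using Suc.prems(2)[of z] zG z(2) zy by auto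
  then have "adjG n0 (G - A) z y" using z(1) \<open>y \<notin> A\<close> by (auto simp: adjG_def)
  ultimately show ?case by simp
qed

text \<open>Exactly one neighbour of \<open>w\<close> is closer to \<open>p\<close>, none if
  \<open>w = p\<close>, and all others are one step farther.\<close>

lemma lap_tdist:
  assumes "p \<in> G" "w \<in> G"
  shows "lap (\<lambda>a. real (tdist p a)) w = (if w = p then 0 else 2) - deg n0 G w"
proof -
  define C where "C = {b \<in> nb w. tdist p b < tdist p w}"
  have "C \<subseteq> nb w" and fin: "finite C" using finite_neighbours[of n0 G w] by (auto simp: C_def)
  have card: "card C = (if w = p then 0 else 1)"
  proof (cases "w = p")
    case True
    then show ?thesis by (simp add: C_def)
  next
    case False
    then obtain z where "adj z w" "tdist p w = Suc (tdist p z)" using closer_neighbour assms by metis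
    then have "z \<in> C" by (simp add: C_def adjG_commute)
    moreover have "b = z" if "b \<in> C" for b
      using that \<open>z \<in> C\<close> adjG_closer_unique[of n0 G w b z p] by (simp add: C_def)
    ultimately have "C = {z}" by blast
    then show ?thesis using False by simp
  qed
  have "lap (\<lambda>a. real (tdist p a)) w = (\<Sum>b\<in>nb w. (if b \<in> C then 2 else 0) - 1)"
    unfolding lap_def
  proof (rule sum.cong)
    fix b assume "b \<in> nb w"
    then show "real (tdist p w) - real (tdist p b) = (if b \<in> C then 2 else 0) - 1"
      using adjG_tdist[of n0 G w b p] by (auto simp: C_def)
  qed simp
  also have "\<dots> = 2 * card (nb w \<inter> C) - deg n0 G w"
    using finite_neighbours[of n0 G w] by (simp add: sum_subtractf sum.If_cases deg_def mult.commute)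
  also have "nb w \<inter> C = C" using \<open>C \<subseteq> nb w\<close> by blast
  finally show ?thesis by (simp add: card)
qed

text \<open>\<open>S z\<close> below is the voltage that is 0 at \<open>x\<close>, 1 at \<open>z\<close>, linear along the geodesic and constant off
  it. Hence \<open>max 0 (1 - \<Sum>\<^sub>z S z)\<close> vanishes beyond the cutset and is subharmonic away from \<open>x\<close>.\<close>

lemma exit_sum_cutset:
  assumes B: "finite B" "B \<subseteq> G" "x \<in> B" and A: "finite A" "A \<subseteq> G" "x \<notin> A"
    and cut: "\<And>w. w \<in> G - B \<Longrightarrow> \<exists>z\<in>A. tdist x z + tdist z w = tdist x w"
    and C: "C = (\<Sum>z\<in>A. 1 / real (tdist x z))"
    and D: "D \<subseteq> B" "\<And>y. y \<in> D \<Longrightarrow> real (tdist x y) \<le> \<delta>"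
  shows "mu n0 G D * (1 - C * \<delta>) \<le> C * exit_sum B x"
proof -
  define S where "S z w = (real (tdist x z) + real (tdist x w) - real (tdist z w)) / (2 * real (tdist x z))" for z w
  define F where "F w = 1 - (\<Sum>z\<in>A. S z w)" for w
  define f where "f w = (if w \<in> B then max 0 (F w) else 0)" for w
  have x: "x \<in> G" using B by blast
  have pos: "real (tdist x z) > 0" if "z \<in> A" for z
    using that A(3) by (metis of_nat_0_less_iff neq0_conv tdist_eq_0_iff)
  have S0: "S z w \<ge> 0" if "z \<in> A" "w \<in> G" for z w
  proof -
    have "real (tdist z w) \<le> real (tdist x z) + real (tdist x w)"
      using tdist_triangle[of z x w] that A x tdist_commute[of z x] by (simp add: subset_iff flip: of_nat_add)
    then show ?thesis using pos[OF that(1)] by (simp add: S_def)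
  qed
  have S1: "S z w \<le> tdist x w / tdist x z" if "z \<in> A" "w \<in> G" for z w
  proof -
    have "real (tdist x z) \<le> real (tdist x w) + real (tdist z w)"
      using tdist_triangle[of x w z] that A x tdist_commute[of z w] by (simp add: subset_iff flip: of_nat_add)
    then have "S z w \<le> 2 * real (tdist x w) / (2 * real (tdist x z))"
      unfolding S_def by (intro divide_right_mono) auto
    then show ?thesis by simp
  qed
  \<comment> \<open>Beyond the cutset some \<open>z\<close> in \<open>A\<close> lies on the geodesic
    from \<open>x\<close> to \<open>w\<close>, so \<open>S z w = 1\<close>, while the other voltages
    are nonnegative.\<close>
  have F_out: "F w \<le> 0" if w: "w \<in> G - B" for w
  proof -
    obtain z where z: "z \<in> A" "tdist x z + tdist z w = tdist x w" using cut[OF w] by blast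
    then have "real (tdist x w) = real (tdist x z) + real (tdist z w)" by simp
    then have "S z w = 1" using z(1) A(3) by (auto simp: S_def)
    moreover have "S z w \<le> (\<Sum>z\<in>A. S z w)" using z(1) A(1) S0 w by (intro member_le_sum) auto
    ultimately show ?thesis by (simp add: F_def)
  qed
  have fF: "f w = max 0 (F w)" if "w \<in> G" for w
    using F_out[of w] that by (auto simp: f_def)
  \<comment> \<open>The degree terms of \<open>lap_tdist\<close> cancel in the difference of the two
    distance functions, leaving point charges at \<open>x\<close> and at \<open>z\<close>.\<close>
  have lapF: "lap F w = (\<Sum>z\<in>A. ((if w = z then 0 else 1) - (if w = x then 0 else 1)) / real (tdist x z))"
    if w: "w \<in> G" for w
  proof -
    have "lap F w = (\<Sum>b\<in>nb w. \<Sum>z\<in>A. ((real (tdist z w) - real (tdist z b)) - (real (tdist x w) - real (tdist x b)))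
        / (2 * real (tdist x z)))"
      unfolding lap_def F_def by (simp add: S_def flip: sum_subtractf diff_divide_distrib) (simp add: algebra_simps)
    also have "\<dots> = (\<Sum>z\<in>A. (lap (\<lambda>a. real (tdist z a)) w - lap (\<lambda>a. real (tdist x a)) w) / (2 * real (tdist x z)))"
      by (subst sum.swap) (simp add: lap_def flip: sum_subtractf sum_divide_distrib)
    also have "\<dots> = (\<Sum>z\<in>A. ((if w = z then 0 else 1) - (if w = x then 0 else 1)) / real (tdist x z))"
      using A(2) x w by (intro sum.cong) (auto simp: lap_tdist subset_iff)
    finally show ?thesis .
  qed
  have lapF_le: "lap F a \<le> (if a = x then C else 0)" if a: "a \<in> G" for a
    unfolding lapF[OF a] C using pos A(3)
    by (auto intro!: sum_nonpos sum_mono divide_right_mono simp: divide_le_0_iff)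
  \<comment> \<open>The positive part stays subharmonic: where \<open>F\<close> is not positive,
    \<open>f\<close> attains its minimum 0.\<close>
  have lapf: "lap f a \<le> (if F a > 0 then lap F a else 0)" if a: "a \<in> G" for a
  proof -
    have "f a - f b \<le> (if F a > 0 then F a - F b else 0)" if "b \<in> nb a" for b
      using fF[OF a] fF[OF adj_in(2), of a b] that by auto
    then have "lap f a \<le> (\<Sum>b\<in>nb a. if F a > 0 then F a - F b else 0)"
      unfolding lap_def by (rule sum_mono)
    then show ?thesis by (auto simp: lap_def split: if_splits)
  qed
  have "F x > 0" by (simp add: F_def S_def tdist_commute)
  have "(\<Sum>a\<in>B. deg n0 G a * f a) \<le> C * exit_sum B x"
  proof (rule exit_sum_test_function[OF B])
    show "f a = 0" if "a \<notin> B" for a using that by (simp add: f_def)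
    show "lap f a \<le> 0" if "a \<in> B" "a \<noteq> x" for a
      using lapf[of a] lapF_le[of a] that B(2) by (auto split: if_splits)
    show "lap f x \<le> C" using lapf[OF x] lapF_le[OF x] \<open>F x > 0\<close> by simp
  qed
  moreover have "mu n0 G D * (1 - C * \<delta>) \<le> (\<Sum>a\<in>D. deg n0 G a * f a)"
    unfolding mu_def sum_distrib_right
  proof (intro sum_mono mult_left_mono deg_nonneg)
    fix y assume y: "y \<in> D"
    then have yG: "y \<in> G" using D(1) B(2) by blast
    have "(\<Sum>z\<in>A. S z y) \<le> (\<Sum>z\<in>A. 1 / real (tdist x z) * \<delta>)"
    proof (rule sum_mono)
      fix z assume z: "z \<in> A"
      have "real (tdist x y) / real (tdist x z) \<le> \<delta> / real (tdist x z)"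
        using D(2)[OF y] by (intro divide_right_mono) auto
      then show "S z y \<le> 1 / real (tdist x z) * \<delta>" using S1[OF z yG] by simp
    qed
    then have "1 - C * \<delta> \<le> F y" by (simp add: F_def C sum_distrib_right)
    then show "1 - C * \<delta> \<le> f y" using fF[OF yG] by simp
  qed
  moreover have "(\<Sum>a\<in>D. deg n0 G a * f a) \<le> (\<Sum>a\<in>B. deg n0 G a * f a)"
    using B(1) D(1) by (intro sum_mono2) (auto simp: deg_nonneg f_def)
  ultimately show ?thesis by linarith
qed

section \<open>Exit times from good balls\<close>

lemma outer_point:
  assumes "x \<in> G" "r \<ge> 0"
  obtains w where "w \<in> G - ball n0 G x r" "real (tdist x w) \<le> r + 1"
proof -
  obtain w where w: "w \<in> G" "tdist x w = Suc (nat \<lfloor>r\<rfloor>)" using sphere_nonempty[OF assms(1)] by blast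
  have "real (tdist x w) = of_int \<lfloor>r\<rfloor> + 1" using w(2) assms(2) by simp
  then have "r < real (tdist x w)" "real (tdist x w) \<le> r + 1" by linarith+
  with w(1) show ?thesis by (intro that) (auto simp: ball_eq[OF assms(1)])
qed

text \<open>The infimum defining \<open>Msep\<close> is a finite extended natural, hence attained. A
  minimiser is nonempty, since the infinite connected \<open>G\<close> reaches outside the ball when
  nothing is removed.\<close>

lemma good_ball_cutset:
  assumes good: "good_ball n0 G lam x r" and r: "r \<ge> 1"
  obtains A where "finite A" "A \<subseteq> G" "A \<noteq> {}"
    "\<And>z. z \<in> A \<Longrightarrow> r / 4 \<le> real (tdist x z) \<and> real (tdist x z) \<le> 3 * r / 4"
    "real (card A) \<le> lam / 64"
    "\<And>w. w \<in> G - ball n0 G x r \<Longrightarrow> \<not> (adjG n0 (G - A))\<^sup>*\<^sup>* x w"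
proof -
  have x: "x \<in> G" using good by (simp add: good_ball_def)
  define X where "X = {A. finite A \<and> A \<subseteq> G \<and>
        (\<forall>z\<in>A. r/4 \<le> real (gdist n0 G x z) \<and> real (gdist n0 G x z) \<le> 3*r/4) \<and>
        \<not> (\<exists>y \<in> G - ball n0 G x r. (adjG n0 (G - A))\<^sup>*\<^sup>* x y)}"
  obtain m where m: "Msep n0 G x r = enat m" "real m \<le> lam / 64"
    using good by (auto simp: good_ball_def)
  have "X \<noteq> {}"
  proof
    assume "X = {}"
    then have "Msep n0 G x r = \<infinity>" unfolding Msep_def X_def[symmetric] by (simp add: Inf_enat_def)
    with m(1) show False by simp
  qed
  then have "Inf ((\<lambda>A. enat (card A)) ` X) \<in> (\<lambda>A. enat (card A)) ` X"
    unfolding Inf_enat_def by (auto intro: LeastI)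
  then obtain A where A: "A \<in> X" "card A = m"
    using m(1) unfolding Msep_def X_def[symmetric] by auto
  have "A \<noteq> {}"
  proof
    assume "A = {}"
    obtain w where w: "w \<in> G - ball n0 G x r"
      by (rule outer_point[OF x, of r]) (use r in auto)
    moreover have "(adjG n0 (G - {}))\<^sup>*\<^sup>* x w" using w x by (intro geodesic_avoiding) auto
    ultimately show False using A(1) \<open>A = {}\<close> by (auto simp: X_def)
  qed
  then show ?thesis
    using that[of A] A m(2) x by (auto simp: X_def gdist_eq_tdist subset_iff)
qed

text \<open>A cutset has at least one point, so \<open>lam / 64\<close> is at least 1; that point
  has integer distance between 1 and 3r/4. The slack in \<open>r\<close> later absorbs the
  \<open>r + 1\<close> of \<open>outer_point\<close>.\<close>

lemma good_ball_size:
  assumes "good_ball n0 G lam x r" "r \<ge> 1"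
  shows "lam \<ge> 64" "r \<ge> 4 / 3"
proof -
  obtain A where A: "finite A" "A \<noteq> {}" "real (card A) \<le> lam / 64"
    "\<And>z. z \<in> A \<Longrightarrow> r / 4 \<le> real (tdist x z) \<and> real (tdist x z) \<le> 3 * r / 4"
    using good_ball_cutset[OF assms] by metis
  have "card A > 0" using A(1,2) by (simp add: card_gt_0_iff)
  then have "real (card A) \<ge> 1" by linarith
  then show "lam \<ge> 64" using A(3) by simp
  obtain z where z: "z \<in> A" using A(2) by blast
  then have "real (tdist x z) > 0" using A(4)[OF z] assms(2) by linarith
  then have "real (tdist x z) \<ge> 1" by simp
  then show "r \<ge> 4 / 3" using A(4)[OF z] by linarith
qed

lemma good_ball_exit_upper:
  fixes r lam :: real
  assumes "good_ball n0 G lam x0 r" "r \<ge> 1" "x \<in> ball n0 G x0 r"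
  shows "exit_sum (ball n0 G x0 r) x \<le> (tdist x0 x + r + 1) * (r\<^sup>2 * lam)"
proof -
  have x0: "x0 \<in> G" and V: "mu n0 G (ball n0 G x0 r) \<le> r\<^sup>2 * lam"
    using assms(1) by (auto simp: good_ball_def vol_def)
  have x: "x \<in> G" using assms(3) by (simp add: ball_def)
  obtain w where w: "w \<in> G - ball n0 G x0 r" "real (tdist x0 w) \<le> r + 1"
    by (rule outer_point[OF x0, of r]) (use assms(2) in auto)
  have "tdist x w \<le> tdist x0 x + tdist x0 w"
    using tdist_triangle[of x x0 w] tdist_commute[of x x0] x x0 w(1) by simp
  then have d: "real (tdist x w) \<le> tdist x0 x + r + 1" using w(2) by linarith
  have "exit_sum (ball n0 G x0 r) x \<le> tdist x w * mu n0 G (ball n0 G x0 r)"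
    by (rule exit_sum_le[OF finite_ball[OF x0] x w(1)])
  also have "\<dots> \<le> (tdist x0 x + r + 1) * (r\<^sup>2 * lam)"
    using d V assms(2) by (intro mult_mono) (auto simp: mu_def sum_nonneg deg_nonneg)
  finally show ?thesis .
qed

text \<open>Points of \<open>A\<close> are at distance at least r/4 - r/64 = 15r/64 from
  \<open>x\<close>, so \<open>C\<close> is at most (lam/64) * 64/(15r) = lam/(15r). On
  \<open>D\<close>, within 2r/lam of \<open>x\<close>, the loss is at most 2/15, and 13/15 divided
  by lam/(15r) is 13r/lam.\<close>

lemma good_ball_exit_lower:
  assumes good: "good_ball n0 G lam x0 r" and r: "r \<ge> 1" and x: "x \<in> ball n0 G x0 (r / lam)"
  shows "13 * r ^ 3 / lam ^ 5 \<le> exit_sum (ball n0 G x0 r) x"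
proof -
  note size = good_ball_size[OF good r]
  obtain A where A: "finite A" "A \<subseteq> G" "real (card A) \<le> lam / 64"
    "\<And>z. z \<in> A \<Longrightarrow> r / 4 \<le> real (tdist x0 z) \<and> real (tdist x0 z) \<le> 3 * r / 4"
    "\<And>w. w \<in> G - ball n0 G x0 r \<Longrightarrow> \<not> (adjG n0 (G - A))\<^sup>*\<^sup>* x0 w"
    using good_ball_cutset[OF good r] by metis
  define B where "B = ball n0 G x0 r"
  define D where "D = ball n0 G x0 (r / lam)"
  define C where "C = (\<Sum>z\<in>A. 1 / real (tdist x z))"
  have x0: "x0 \<in> G" and V: "r\<^sup>2 / lam ^ 4 \<le> mu n0 G D"
    using good by (auto simp: good_ball_def vol_def D_def)
  have xG: "x \<in> G" and dx: "real (tdist x0 x) \<le> r / lam" using x by (auto simp: ball_eq[OF x0])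
  have rl: "r / lam \<le> r / 64" using size(1) r by (intro divide_left_mono) auto
  have "r / lam \<le> r" using rl r by linarith
  then have B: "finite B" "B \<subseteq> G" "x \<in> B" and "D \<subseteq> B"
    using finite_ball[OF x0, of r] xG dx by (auto simp: B_def D_def ball_eq[OF x0])
  have "x \<notin> A" using A(4)[of x] dx rl r by auto
  have cut: "\<exists>z\<in>A. tdist x z + tdist z w = tdist x w" if w: "w \<in> G - B" for w
  proof (rule ccontr)
    assume "\<not> ?thesis"
    then have "(adjG n0 (G - A))\<^sup>*\<^sup>* x w" using w xG by (intro geodesic_avoiding) auto
    \<comment> \<open>Separation is known only from \<open>x0\<close>; the geodesic from
      \<open>x0\<close> to \<open>x\<close> stays within r/lam < r/4 and so avoids
      \<open>A\<close>.\<close>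
    moreover have "tdist x0 z + tdist z x \<noteq> tdist x0 x" if "z \<in> A" for z
    proof -
      have "real (tdist x0 x) < real (tdist x0 z)" using A(4)[OF that] dx rl r by linarith
      then show ?thesis by simp
    qed
    then have "(adjG n0 (G - A))\<^sup>*\<^sup>* x0 x" using x0 xG by (intro geodesic_avoiding) auto
    ultimately show False using A(5) w unfolding B_def by (meson rtranclp_trans)
  qed
  have dz: "15 * r / 64 \<le> real (tdist x z)" if "z \<in> A" for z
  proof -
    have "tdist x0 z \<le> tdist x0 x + tdist x z" using tdist_triangle x0 xG that A(2) by blast
    then have "real (tdist x0 z) \<le> real (tdist x0 x) + real (tdist x z)" by linarith
    then show ?thesis using A(4)[OF that] dx rl by linarith
  qed
  have "C \<le> (\<Sum>z\<in>A. 64 / (15 * r))"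
    unfolding C_def
  proof (rule sum_mono)
    fix z assume "z \<in> A"
    from dz[OF this] r show "1 / real (tdist x z) \<le> 64 / (15 * r)"
      by (simp add: field_simps)
  qed
  also have "\<dots> = card A * (64 / (15 * r))" by simp
  also have "\<dots> \<le> lam / 64 * (64 / (15 * r))" using A(3) r by (intro mult_right_mono) auto
  finally have C: "C \<le> lam / (15 * r)" by simp
  have dD: "real (tdist x y) \<le> 2 * r / lam" if "y \<in> D" for y
  proof -
    have y: "y \<in> G" "real (tdist x0 y) \<le> r / lam" using that by (auto simp: D_def ball_eq[OF x0])
    have "tdist x y \<le> tdist x0 x + tdist x0 y"
      using tdist_triangle[of x x0 y] tdist_commute[of x x0] xG x0 y(1) by simp
    then show ?thesis using y(2) dx by linarith
  qed
  have main: "mu n0 G D * (1 - C * (2 * r / lam)) \<le> C * exit_sum B x"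
    by (rule exit_sum_cutset[OF B A(1,2) \<open>x \<notin> A\<close> cut C_def \<open>D \<subseteq> B\<close> dD])
  have "C * (2 * r / lam) \<le> lam / (15 * r) * (2 * r / lam)"
    using C r size(1) by (intro mult_right_mono) auto
  also have "\<dots> = 2 / 15" using r size(1) by (simp add: field_simps)
  finally have "13 / 15 \<le> 1 - C * (2 * r / lam)" by simp
  then have "r\<^sup>2 / lam ^ 4 * (13 / 15) \<le> mu n0 G D * (1 - C * (2 * r / lam))"
    using V r by (intro mult_mono) (auto simp: mu_def sum_nonneg deg_nonneg)
  also have "\<dots> \<le> lam / (15 * r) * exit_sum B x"
    using main mult_right_mono[OF C exit_sum_nonneg[OF B(1,2), of x]] by linarith
  finally have "r\<^sup>2 / lam ^ 4 * (13 / 15) * (15 * r / lam) \<le> lam / (15 * r) * exit_sum B x * (15 * r / lam)"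
    using r size(1) by (intro mult_right_mono) auto
  moreover have "lam / (15 * r) * exit_sum B x * (15 * r / lam) = exit_sum B x"
    using r size(1) by simp
  moreover have "r\<^sup>2 / lam ^ 4 * (13 / 15) * (15 * r / lam) = 13 * r ^ 3 / lam ^ 5"
    by (simp add: power2_eq_square power3_eq_cube eval_nat_numeral)
  ultimately show ?thesis by (simp add: B_def)
qed

end

subsection \<open>Heat kernel bounds in good balls\<close>

text \<open>With \<tau> the cube root of \<open>t\<close>, membership in the time interval becomes
  two polynomial inequalities. The upper end gives \<tau> lam^(5/3) \<le> r, weakened to an integer
  power.\<close>

lemma cube_root_time_scale:
  fixes r lam t :: real
  assumes "r \<ge> 1" "lam \<ge> 1" "t \<in> {r ^ 3 / lam ^ 6 .. r ^ 3 / lam ^ 5}"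
  obtains \<tau> where "\<tau> > 0" "t = \<tau> ^ 3" "t powr (1/3) = \<tau>" "t powr (-2/3) = 1 / \<tau>\<^sup>2"
    "r \<le> \<tau> * lam\<^sup>2" "\<tau> * lam \<le> r"
proof -
  define \<tau> where "\<tau> = t powr (1/3)"
  have "0 < r ^ 3 / lam ^ 6" using assms(1,2) by simp
  then have t: "t > 0" using assms(3) by auto
  then have \<tau>: "\<tau> > 0" by (simp add: \<tau>_def)
  have \<tau>3: "t = \<tau> ^ 3"
    using t by (simp add: \<tau>_def powr_powr flip: powr_numeral)
  have p: "t powr (-2/3) = 1 / \<tau>\<^sup>2"
  proof -
    have "\<tau>\<^sup>2 = t powr (2/3)" using t by (simp add: \<tau>_def powr_powr flip: powr_numeral)
    then show ?thesis using powr_minus_divide[of t "2/3"] by simp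
  qed
  have "r ^ 3 / lam ^ 6 \<le> \<tau> ^ 3" using assms(3) \<tau>3 by simp
  then have "r ^ 3 \<le> \<tau> ^ 3 * lam ^ 6" using assms(2) by (simp add: divide_le_eq)
  then have "r ^ 3 \<le> (\<tau> * lam\<^sup>2) ^ 3" by (simp add: power_mult_distrib flip: power_mult)
  then have up: "r \<le> \<tau> * lam\<^sup>2" by (rule power_le_imp_le_base[of _ 2, simplified]) (use \<tau> in simp)
  have "(\<tau> * lam) ^ 3 = \<tau> ^ 3 * lam ^ 3" by (simp add: power_mult_distrib)
  also have "\<dots> \<le> \<tau> ^ 3 * lam ^ 5" using \<tau> assms(2) by (intro mult_left_mono power_increasing) auto
  also have "\<dots> \<le> r ^ 3" using assms(2,3) \<tau>3 by (simp add: le_divide_eq)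
  finally have lo: "\<tau> * lam \<le> r" by (rule power_le_imp_le_base[of _ 2, simplified]) (use assms(1) in simp)
  show ?thesis using that[OF \<tau> \<tau>3 _ p up lo] \<tau>_def by simp
qed

context infinite_subtree
begin

text \<open>With radius r/lam both terms of the maximum in \<open>heat_kernel_diagonal_upper\<close>
  are at most 2 lam^2/\<tau>^2. Off the diagonal the gradient adds at most sqrt K * lam/\<tau>^2,
  and \<open>lam \<ge> 64\<close> absorbs the factor 2 into lam^3.\<close>

lemma good_ball_heat_upper:
  assumes good: "good_ball n0 G lam x0 r" and r: "r \<ge> 1" and K: "K \<ge> 0"
    and t: "t \<in> {r ^ 3 / lam ^ 6 .. r ^ 3 / lam ^ 5}" and y: "y \<in> ball n0 G x0 (K * t powr (1/3))"
  shows "q n0 G (2 * t) x0 y \<le> (1 + sqrt K) * t powr (-2/3) * lam ^ 3"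
proof -
  have lam: "lam \<ge> 64" by (rule good_ball_size[OF good r])
  obtain \<tau> where \<tau>: "\<tau> > 0" "t = \<tau> ^ 3" "t powr (1/3) = \<tau>" "t powr (-2/3) = 1 / \<tau>\<^sup>2"
    "r \<le> \<tau> * lam\<^sup>2" "\<tau> * lam \<le> r"
    by (rule cube_root_time_scale[OF r _ t]) (use lam in auto)
  have x0: "x0 \<in> G" and V: "r\<^sup>2 / lam ^ 4 \<le> vol n0 G x0 (r / lam)"
    using good by (auto simp: good_ball_def)
  have yG: "y \<in> G" and dy: "real (tdist x0 y) \<le> K * \<tau>" using y by (auto simp: ball_eq[OF x0] \<tau>(3))
  define Q where "Q = q n0 G (2 * t) x0 x0"
  have t0: "2 * t > 0" using \<tau> by simp
  have Q0: "Q \<ge> 0" unfolding Q_def using q_nonneg[OF x0 x0] t0 by simp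
  have "0 < r\<^sup>2 / lam ^ 4" using r lam by simp
  with V have "2 / vol n0 G x0 (r / lam) \<le> 2 / (r\<^sup>2 / lam ^ 4)"
    by (intro divide_left_mono mult_pos_pos) linarith+
  also have "\<dots> = 2 * lam ^ 4 / r\<^sup>2" by simp
  also have "\<dots> \<le> 2 * lam ^ 4 / (\<tau> * lam)\<^sup>2"
    using \<tau>(1,6) lam r by (intro divide_left_mono power_mono) auto
  also have "\<dots> = 2 * lam\<^sup>2 / \<tau>\<^sup>2" using lam by (simp add: power_mult_distrib eval_nat_numeral)
  finally have 1: "2 / vol n0 G x0 (r / lam) \<le> 2 * lam\<^sup>2 / \<tau>\<^sup>2" .
  have "4 * (r / lam) / (2 * t) \<le> 4 * (\<tau> * lam\<^sup>2 / lam) / (2 * t)"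
    using \<tau>(5) lam t0 by (intro divide_right_mono mult_left_mono) auto
  also have "\<dots> = 2 * lam / \<tau>\<^sup>2" using \<tau>(1) lam by (simp add: \<tau>(2) eval_nat_numeral)
  also have "\<dots> \<le> 2 * lam\<^sup>2 / \<tau>\<^sup>2"
    using lam by (intro divide_right_mono) (auto simp: power2_eq_square)
  finally have 2: "4 * (r / lam) / (2 * t) \<le> 2 * lam\<^sup>2 / \<tau>\<^sup>2" .
  have Q: "Q \<le> 2 * lam\<^sup>2 / \<tau>\<^sup>2"
    using heat_kernel_diagonal_upper[OF x0 t0, of "r / lam"] 1 2 r lam unfolding Q_def by auto
  have "(q n0 G (2 * t) x0 y - Q)\<^sup>2 \<le> tdist x0 y * Q / (2 * t)"
    unfolding Q_def by (rule heat_kernel_gradient[OF x0 yG t0])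
  also have "\<dots> \<le> K * \<tau> * (2 * lam\<^sup>2 / \<tau>\<^sup>2) / (2 * t)"
    using dy Q Q0 t0 K \<tau>(1) by (intro divide_right_mono mult_mono) auto
  also have "\<dots> = (sqrt K * lam / \<tau>\<^sup>2)\<^sup>2"
    using K \<tau>(1) by (simp add: \<tau>(2) power_divide power_mult_distrib) (simp add: eval_nat_numeral)
  finally have "q n0 G (2 * t) x0 y - Q \<le> sqrt K * lam / \<tau>\<^sup>2"
    using K lam by (intro power2_le_imp_le[of "q n0 G (2 * t) x0 y - Q"]) auto
  then have "q n0 G (2 * t) x0 y \<le> (2 * lam\<^sup>2 + sqrt K * lam) / \<tau>\<^sup>2"
    using Q by (simp add: add_divide_distrib)
  also have "\<dots> \<le> ((1 + sqrt K) * lam ^ 3) / \<tau>\<^sup>2"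
  proof (rule divide_right_mono)
    have "2 * lam\<^sup>2 \<le> lam * lam\<^sup>2" using lam by (intro mult_right_mono) auto
    moreover have "sqrt K * lam \<le> sqrt K * lam ^ 3"
      using lam K by (intro mult_left_mono self_le_power) auto
    ultimately show "2 * lam\<^sup>2 + sqrt K * lam \<le> (1 + sqrt K) * lam ^ 3"
      by (simp add: algebra_simps power3_eq_cube power2_eq_square)
  qed simp
  finally show ?thesis unfolding \<tau>(4) by simp
qed

text \<open>From any point of \<open>B\<close> the mean exit time is at most 3 lam r^3, as 2r + 1
  \<le> 3r. From \<open>x\<close> it exceeds \<open>t\<close> by at least (13 - 1) r^3/lam^5, so
  survival has probability at least 4/lam^6; its square is divided by mu(B) \<le> r^2 lam.\<close>

lemma good_ball_heat_diagonal_lower: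
  assumes good: "good_ball n0 G lam x0 r" and r: "r \<ge> 1" and x: "x \<in> ball n0 G x0 (r / lam)"
    and t: "0 \<le> t" "t \<le> r ^ 3 / lam ^ 5"
  shows "16 / (lam ^ 13 * r\<^sup>2) \<le> q n0 G (2 * t) x x"
proof -
  have lam: "lam \<ge> 64" by (rule good_ball_size[OF good r])
  define B where "B = ball n0 G x0 r"
  have x0: "x0 \<in> G" and V: "mu n0 G B \<le> r\<^sup>2 * lam"
    using good by (auto simp: good_ball_def vol_def B_def)
  have xG: "x \<in> G" using x by (simp add: ball_def)
  have B: "finite B" "B \<subseteq> G" using finite_ball[OF x0, of r] by (auto simp: B_def ball_def)
  have T: "exit_sum B y \<le> 3 * lam * r ^ 3" if "y \<in> B" for y
  proof -
    have "real (tdist x0 y) \<le> r" using that by (simp add: B_def ball_eq[OF x0])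
    then have "(tdist x0 y + r + 1) * (r\<^sup>2 * lam) \<le> (3 * r) * (r\<^sup>2 * lam)"
      using r lam by (intro mult_right_mono) auto
    then show ?thesis
      using good_ball_exit_upper[OF good r, of y] that by (simp add: B_def power2_eq_square power3_eq_cube mult_ac)
  qed
  have "4 / lam ^ 6 = (12 * r ^ 3 / lam ^ 5) / (3 * lam * r ^ 3)"
    using r lam by (simp add: eval_nat_numeral)
  also have "\<dots> \<le> (exit_sum B x - t) / (3 * lam * r ^ 3)"
    using good_ball_exit_lower[OF good r x] t(2) r lam unfolding B_def[symmetric]
    by (intro divide_right_mono) auto
  also have "\<dots> \<le> surv n0 G B x t" using r lam T t(1) by (intro surv_ge B) auto
  also have "\<dots> \<le> (\<Sum>y\<in>B. trans_prob n0 G t x y)" by (rule surv_le_sum_trans_prob[OF B(1) t(1)])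
  finally have "(4 / lam ^ 6)\<^sup>2 \<le> (\<Sum>y\<in>B. trans_prob n0 G t x y)\<^sup>2"
    using lam by (intro power_mono) auto
  also have "\<dots> \<le> mu n0 G B * q n0 G (2 * t) x x" by (rule heat_kernel_cauchy_schwarz[OF xG B t(1)])
  also have "\<dots> \<le> (r\<^sup>2 * lam) * q n0 G (2 * t) x x"
    using V q_nonneg[OF xG xG, of "2 * t"] t(1) by (intro mult_right_mono) auto
  finally have "16 / lam ^ 12 \<le> (r\<^sup>2 * lam) * q n0 G (2 * t) x x"
    by (simp add: power_divide flip: power_mult)
  then have "16 / lam ^ 12 / (r\<^sup>2 * lam) \<le> q n0 G (2 * t) x x"
    using r lam by (subst pos_divide_le_eq) (simp_all add: mult.commute)
  moreover have "lam ^ 13 = lam ^ 12 * lam" by (simp flip: power_Suc2)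
  then have "16 / lam ^ 12 / (r\<^sup>2 * lam) = 16 / (lam ^ 13 * r\<^sup>2)" by (simp add: mult_ac)
  ultimately show ?thesis by (simp only:)
qed

text \<open>Since r \<le> \<tau> lam^2, the diagonal value \<open>Q\<close> is at least 16/(lam^17
  \<tau>^2). The radius 8r/lam^19 makes the distance at most Qt/2, so by the gradient estimate the
  kernel at \<open>y\<close> differs from \<open>Q\<close> by at most Q/2.\<close>

lemma good_ball_heat_lower:
  assumes good: "good_ball n0 G lam x0 r" and r: "r \<ge> 1" and x: "x \<in> ball n0 G x0 (r / lam)"
    and t: "t \<in> {r ^ 3 / lam ^ 6 .. r ^ 3 / lam ^ 5}"
    and y: "y \<in> G" "real (gdist n0 G x y) \<le> 8 * r / lam ^ 19"
  shows "8 * t powr (-2/3) / lam ^ 17 \<le> q n0 G (2 * t) x y"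
proof -
  have lam: "lam \<ge> 64" by (rule good_ball_size[OF good r])
  obtain \<tau> where \<tau>: "\<tau> > 0" "t = \<tau> ^ 3" "t powr (1/3) = \<tau>" "t powr (-2/3) = 1 / \<tau>\<^sup>2"
    "r \<le> \<tau> * lam\<^sup>2" "\<tau> * lam \<le> r"
    by (rule cube_root_time_scale[OF r _ t]) (use lam in auto)
  have xG: "x \<in> G" using x by (simp add: ball_def)
  have dy: "real (tdist x y) \<le> 8 * r / lam ^ 19" using y by (simp add: gdist_eq_tdist[OF xG])
  define Q where "Q = q n0 G (2 * t) x x"
  have t0: "t > 0" using \<tau>(1,2) by simp
  have "lam ^ 17 = lam ^ 13 * (lam\<^sup>2)\<^sup>2" by (simp flip: power_add power_mult)
  then have "16 / (lam ^ 17 * \<tau>\<^sup>2) = 16 / (lam ^ 13 * (\<tau> * lam\<^sup>2)\<^sup>2)"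
    by (simp add: power_mult_distrib mult_ac)
  also have "\<dots> \<le> 16 / (lam ^ 13 * r\<^sup>2)"
    using \<tau>(5) r lam by (intro divide_left_mono mult_left_mono power_mono mult_pos_pos) auto
  also have "\<dots> \<le> Q"
    unfolding Q_def using t t0 by (intro good_ball_heat_diagonal_lower[OF good r x]) auto
  finally have Q: "16 / (lam ^ 17 * \<tau>\<^sup>2) \<le> Q" .
  moreover have "16 / (lam ^ 17 * \<tau>\<^sup>2) > 0" using lam \<tau>(1) by simp
  ultimately have Q0: "Q > 0" by linarith
  have "2 * real (tdist x y) \<le> 16 * r / lam ^ 19" using dy by simp
  also have "\<dots> \<le> 16 * (\<tau> * lam\<^sup>2) / lam ^ 19"
    using \<tau>(5) lam by (intro divide_right_mono mult_left_mono) auto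
  also have "\<dots> = 16 * (\<tau> * lam\<^sup>2) / (lam ^ 17 * lam\<^sup>2)" by (simp flip: power_add)
  also have "\<dots> = 16 / (lam ^ 17 * \<tau>\<^sup>2) * t"
    using lam \<tau>(1) by (simp add: \<tau>(2) power2_eq_square power3_eq_cube)
  also have "\<dots> \<le> Q * t" using Q t0 by (intro mult_right_mono) auto
  finally have d: "real (tdist x y) \<le> Q * t / 2" by simp
  have "(q n0 G (2 * t) x y - Q)\<^sup>2 \<le> tdist x y * Q / (2 * t)"
    unfolding Q_def using t0 by (intro heat_kernel_gradient xG y(1)) simp
  also have "\<dots> \<le> (Q * t / 2) * Q / (2 * t)"
    using d Q0 t0 by (intro divide_right_mono mult_right_mono) auto
  also have "\<dots> = (Q / 2)\<^sup>2" using t0 by (simp add: power2_eq_square)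
  finally have "(Q - q n0 G (2 * t) x y)\<^sup>2 \<le> (Q / 2)\<^sup>2" by (subst power2_commute)
  then have "Q - q n0 G (2 * t) x y \<le> Q / 2"
    by (rule power2_le_imp_le) (use Q0 in simp)
  then have "Q / 2 \<le> q n0 G (2 * t) x y" by linarith
  moreover have "16 / (lam ^ 17 * \<tau>\<^sup>2) / 2 \<le> Q / 2" using Q by (rule divide_right_mono) simp
  ultimately have "16 / (lam ^ 17 * \<tau>\<^sup>2) / 2 \<le> q n0 G (2 * t) x y" by (rule order_trans[rotated])
  moreover have "8 * t powr (-2/3) / lam ^ 17 = 16 / (lam ^ 17 * \<tau>\<^sup>2) / 2" unfolding \<tau>(4) by simp
  ultimately show ?thesis by (simp only:)
qed

end

theorem theorem4p7:
  fixes n0 :: nat and G :: "nat list set"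
  assumes "n0 \<ge> 2"
    and "\<forall>x\<in>G. tree_vertex n0 x"
    and "infinite G"
    and "connected_sub n0 G"
  shows "\<exists>c0 c1 c2 :: real. c0 > 0 \<and> c1 > 0 \<and> c2 > 0 \<and>
    (\<forall>x0 r lam. x0 \<in> G \<longrightarrow> r \<ge> 1 \<longrightarrow> lam \<ge> 1 \<longrightarrow> good_ball n0 G lam x0 r \<longrightarrow>
      (\<forall>x \<in> ball n0 G x0 (r / lam).
          ennreal (c0 * r ^ 3 / lam ^ 5) \<le> exit_time_mean n0 G (ball n0 G x0 r) x \<and>
          exit_time_mean n0 G (ball n0 G x0 r) x \<le> ennreal (2 * lam * r ^ 3)) \<and>
      (\<forall>K \<ge> 0. \<forall>t \<in> {r ^ 3 / lam ^ 6 .. r ^ 3 / lam ^ 5}.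
          \<forall>y \<in> ball n0 G x0 (K * t powr (1/3)).
            q n0 G (2 * t) x0 y \<le> (1 + sqrt K) * t powr (-2/3) * lam ^ 3) \<and>
      (\<forall>x \<in> ball n0 G x0 (r / lam). \<forall>y \<in> G. \<forall>t \<in> {r ^ 3 / lam ^ 6 .. r ^ 3 / lam ^ 5}.
          real (gdist n0 G x y) \<le> c2 * r / lam ^ 19 \<longrightarrow>
          q n0 G (2 * t) x y \<ge> c1 * t powr (-2/3) / lam ^ 17))"
proof -
  interpret infinite_subtree n0 G
    using assms(3,4) by unfold_locales
  have exit: "ennreal (13 * r ^ 3 / lam ^ 5) \<le> exit_time_mean n0 G (ball n0 G x0 r) x \<and>
      exit_time_mean n0 G (ball n0 G x0 r) x \<le> ennreal (2 * lam * r ^ 3)"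
    if "x0 \<in> G" "r \<ge> 1" "good_ball n0 G lam x0 r" "x \<in> ball n0 G x0 (r / lam)" for x0 r lam x
  proof -
    note size = good_ball_size[OF that(3,2)]
    have B: "finite (ball n0 G x0 r)" "ball n0 G x0 r \<subseteq> G"
      using finite_ball[OF that(1), of r] by (auto simp: ball_def)
    have "r / lam \<le> r / 64" using size(1) that(2) by (intro divide_left_mono) auto
    moreover have "real (tdist x0 x) \<le> r / lam" using that(4) by (simp add: ball_eq[OF that(1)])
    ultimately have d: "real (tdist x0 x) \<le> r / 64" by linarith
    then have "x \<in> ball n0 G x0 r" using that(2,4) by (simp add: ball_eq[OF that(1)])
    then have "exit_sum (ball n0 G x0 r) x \<le> (tdist x0 x + r + 1) * (r\<^sup>2 * lam)"
      by (rule good_ball_exit_upper[OF that(3,2)])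
    \<comment> \<open>As r \<ge> 4/3, r/64 + r + 1 \<le> 2r.\<close>
    also have "\<dots> \<le> (2 * r) * (r\<^sup>2 * lam)"
      using d size by (intro mult_right_mono) auto
    also have "\<dots> = 2 * lam * r ^ 3" by (simp add: power2_eq_square power3_eq_cube)
    finally show ?thesis
      using good_ball_exit_lower[OF that(3,2,4)] by (simp add: exit_time_mean_eq[OF B] ennreal_leI)
  qed
  show ?thesis
  \<comment> \<open>13 is the exit-time constant, the first 8 is half of the diagonal constant 16,
    and the second 8 fixes the radius on which half of the diagonal value survives.\<close>
  proof (rule exI[of _ 13], rule exI[of _ 8], rule exI[of _ 8], intro conjI allI impI)
    fix x0 r lam
    assume "x0 \<in> G" and r: "r \<ge> 1" and good: "good_ball n0 G lam x0 r"
    show "\<forall>x \<in> ball n0 G x0 (r / lam).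
          ennreal (13 * r ^ 3 / lam ^ 5) \<le> exit_time_mean n0 G (ball n0 G x0 r) x \<and>
          exit_time_mean n0 G (ball n0 G x0 r) x \<le> ennreal (2 * lam * r ^ 3)"
      using exit[OF \<open>x0 \<in> G\<close> r good] by blast
    show "\<forall>t \<in> {r ^ 3 / lam ^ 6 .. r ^ 3 / lam ^ 5}. \<forall>y \<in> ball n0 G x0 (K * t powr (1/3)).
            q n0 G (2 * t) x0 y \<le> (1 + sqrt K) * t powr (-2/3) * lam ^ 3" if "K \<ge> 0" for K
      using good_ball_heat_upper[OF good r that] by blast
    show "\<forall>x \<in> ball n0 G x0 (r / lam). \<forall>y \<in> G. \<forall>t \<in> {r ^ 3 / lam ^ 6 .. r ^ 3 / lam ^ 5}.
          real (gdist n0 G x y) \<le> 8 * r / lam ^ 19 \<longrightarrow>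
          q n0 G (2 * t) x y \<ge> 8 * t powr (-2/3) / lam ^ 17"
      using good_ball_heat_lower[OF good r] by blast
  qed simp_all
qed

end
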